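(* Let $\sigma\in[0,2\pi]$, $m\in\mathbb{Z}_{\ge0}$, $\mathbf{k}=(k_1,\dots,k_n)\in\mathbb{N}^n$ and $\mathbf{l}=(l_1,\dots,l_n)\in(\mathbb{Z}_{\ge0})^n$ with $k_u-1-l_u\ge0$ for all $u$. Then each of $\mathrm{Ls}_{\mathbf{k}}^{\mathbf{l}}(2m\pi+\sigma)$ and $\mathrm{Ls}_{\mathbf{k}}^{\mathbf{l}}(-(2m\pi+\sigma))$ can be written as a $\mathbb{Q}(i)$-linear combination of products of a power of $\sigma$, a power of $\pi$, multiple zeta values, and multiple polylogarithms $\mathrm{Li}_{\mathbf{a}}(e^{i\sigma})$ with admissible indices $\mathbf{a}$.
   Context: With $A(\theta)=\log|2\sin(\theta/2)|$, the iterated log-sine integral is $\mathrm{Ls}_{\mathbf{k}}^{\mathbf{l}}(\sigma)=(-1)^n\int_0^{\sigma}\int_0^{\theta_n}\cdots\int_0^{\theta_2}\prod_{u=1}^n\theta_u^{l_u}A(\theta_u)^{k_u-1-l_u}\,d\theta_1\cdots d\theta_n$ (iterated oriented integrals), $\mathrm{Ls}_\emptyset^\emptyset=1$. An index $(a_1,\dots,a_r)\in\mathbb{N}^r$ is admissible if $a_r\ge2$ (the empty index is admissible). Multiple zeta values: $\zeta(a_1,\dots,a_r)=\sum_{0<m_1<\dots<m_r}m_1^{-a_1}\cdots m_r^{-a_r}$ for admissible indices, $\zeta(\emptyset)=1$. Multiple polylogarithms: $\mathrm{Li}_{a_1,\dots,a_r}(z)=\sum_{0<m_1<\dots<m_r}\frac{z^{m_r}}{m_1^{a_1}\cdots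 m_r^{a_r}}$, $\mathrm{Li}_\emptyset=1$; for admissible indices it converges on $|z|\le1$. *)

theory Defs
  imports "HOL-Analysis.Analysis"
begin

text \<open>A(theta) = log |2 sin(theta/2)|  (ln 0 = 0 at the measure-zero singular points).\<close>
definition logsineA :: "real \<Rightarrow> real" where
  "logsineA \<theta> = ln \<bar>2 * sin (\<theta> / 2)\<bar>"

text \<open>Iterated oriented integral. The list is given OUTERMOST first:
  the pair (k,l) at the head is integrated last (variable theta_n).
  F [] theta = 1,  F ((k,l)#rest) theta = int_0^theta t^l A(t)^(k-1-l) F rest t dt (oriented).\<close>
fun ls_iter :: "(nat \<times> nat) list \<Rightarrow> real \<Rightarrow> real" where
  "ls_iter [] \<theta> = 1"
| "ls_iter ((k, l) # rest) \<theta> =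
     (LBINT t = 0..ereal \<theta>. t ^ l * logsineA t ^ (k - 1 - l) * ls_iter rest t)"

text \<open>Ls_k^l(sigma) with k = (k_1,...,k_n), l = (l_1,...,l_n) (lists, index u = 1..n);
  theta_1 is innermost, so the list of pairs is reversed.\<close>
definition Ls :: "nat list \<Rightarrow> nat list \<Rightarrow> real \<Rightarrow> real" where
  "Ls ks ls \<sigma> = (-1) ^ length ks * ls_iter (rev (zip ks ls)) \<sigma>"

definition admissible :: "nat list \<Rightarrow> bool" where
  "admissible as \<longleftrightarrow> (\<forall>a\<in>set as. 1 \<le> a) \<and> (as = [] \<or> 2 \<le> last as)"

definition incr_tuples :: "nat \<Rightarrow> nat list set" where
  "incr_tuples r = {ms. length ms = r \<and> sorted_wrt (<) ms \<and> (\<forall>m\<in>set ms. 0 < m)}"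

definition mzv :: "nat list \<Rightarrow> real" where
  "mzv as = (if as = [] then 1 else
     (\<Sum>\<^sub>\<infinity> ms \<in> incr_tuples (length as).
        1 / (\<Prod>j<length as. real (ms ! j) ^ (as ! j))))"

definition mpolylog :: "nat list \<Rightarrow> complex \<Rightarrow> complex" where
  "mpolylog as z = (if as = [] then 1 else
     (\<Sum>\<^sub>\<infinity> ms \<in> incr_tuples (length as).
        z ^ (last ms) / (\<Prod>j<length as. of_nat (ms ! j) ^ (as ! j))))"

text \<open>A term of the linear combination: (a, b, p, q, zeta index, polylog index) stands for
  (a + b i) * sigma^p * pi^q * zeta(zeta index) * Li_(polylog index)(e^{i sigma}).\<close>
type_synonym lc_term = "rat \<times> rat \<times> nat \<times> nat \<times> nat list \<times> nat list"

definition lc_term_ok :: "lc_term \<Rightarrow> bool" where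
  "lc_term_ok t = (case t of (a, b, p, q, zs, as) \<Rightarrow> admissible zs \<and> admissible as)"

definition lc_eval :: "lc_term list \<Rightarrow> real \<Rightarrow> complex" where
  "lc_eval ts \<sigma> = (\<Sum>t\<leftarrow>ts. case t of (a, b, p, q, zs, as) \<Rightarrow>
      (of_rat a + \<i> * of_rat b) * complex_of_real (\<sigma> ^ p) * complex_of_real (pi ^ q)
      * complex_of_real (mzv zs) * mpolylog as (exp (\<i> * complex_of_real \<sigma>)))"

end

theory Submission
  imports Defs "HOL-Complex_Analysis.Cauchy_Integral_Formula"
begin

text \<open>On the circle, \<open>A(\<theta>) = log(1 - e\<^sup>i\<^sup>\<theta>) - i(\<theta> - \<pi>)/2\<close> for
  \<open>0 < \<theta> < 2\<pi>\<close>, so every integrand is a polynomial in \<open>\<theta>\<close>, \<open>\<pi>\<close> and multiple polylogarithms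
  (iterated integrals of \<open>dz/z\<close> and \<open>dz/(1-z)\<close>, continued to the plane slit along
  \<open>[1,\<infinity>)\<close>) at \<open>e\<^sup>i\<^sup>\<theta>\<close>. The shuffle product linearises such polynomials. Integrating
  \<open>\<theta>\<^sup>p Li\<^sub>a(e\<^sup>i\<^sup>\<theta>)\<close> by parts raises the last entry of the index, hence antiderivatives involve admissible
  indices only; they are continuous on \<open>[0,2\<pi>]\<close> and their values at both ends lie in the ring spanned
  by powers of \<open>\<pi>\<close> and multiple zeta values. Since \<open>A\<close> is even and \<open>2\<pi>\<close>-periodic, induction on the depth and on
  the number of periods gives the positive arguments, and a parity argument the negative ones.\<close>

section \<open>Hyperlogarithms on the slit plane\<close>

text \<open>The plane without the ray [1, infinity), phrased through \<open>1 - z\<close> because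
  this is exactly where the principal branch \<open>Ln (1 - z)\<close> is holomorphic.\<close>

definition slit :: "complex set" where
  "slit = {z. 1 - z \<notin> \<real>\<^sub>\<le>\<^sub>0}"

section \<open>Topology of the slit plane\<close>

lemma open_slit: "open slit"
proof -
  have "slit = (\<lambda>z. 1 - z) -` (- \<real>\<^sub>\<le>\<^sub>0)"
    by (auto simp: slit_def)
  moreover have "open ((\<lambda>z. 1 - z) -` (- \<real>\<^sub>\<le>\<^sub>0 :: complex set))"
    by (intro open_vimage open_Compl closed_nonpos_Reals_complex continuous_intros)
  ultimately show ?thesis
    by simp
qed

lemma zero_in_slit [simp]: "0 \<in> slit"
  by (simp add: slit_def)

lemma one_notin_slit: "1 \<notin> slit"
  by (simp add: slit_def)

lemma in_slit_if_Re_less: "Re z < 1 \<Longrightarrow> z \<in> slit"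
  by (auto simp: slit_def complex_nonpos_Reals_iff)

lemma ball_subset_slit: "ball 0 1 \<subseteq> slit"
proof
  fix z :: complex
  assume "z \<in> ball 0 1"
  then show "z \<in> slit"
    using complex_Re_le_cmod[of z] by (intro in_slit_if_Re_less) auto
qed

text \<open>On the real axis the condition is \<open>Re z < 1\<close>, which shrinking preserves;
  off the axis a positive factor keeps the imaginary part nonzero. This makes \<open>slit\<close>
  star-shaped about 0, so holomorphic functions on it have primitives.\<close>

lemma scaleR_in_slit:
  assumes "z \<in> slit" "0 \<le> c" "c \<le> 1"
  shows "c *\<^sub>R z \<in> slit"
proof (cases "Im z = 0")
  case True
  then have "Re z < 1"
    using assms(1) by (simp add: slit_def complex_nonpos_Reals_iff)
  then have "c * Re z < 1"
    using assms(2,3) mult_nonneg_nonpos[of c "Re z"] mult_left_le_one_le[of "Re z" c]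
    by linarith
  then show ?thesis
    by (intro in_slit_if_Re_less) simp
next
  case False
  then show ?thesis
    using assms by (cases "c = 0") (auto simp: slit_def complex_nonpos_Reals_iff)
qed

lemma starlike_slit: "starlike slit"
  unfolding starlike_def
proof (intro bexI[of _ 0] ballI subsetI)
  fix z w
  assume "z \<in> slit" "w \<in> closed_segment 0 z"
  then show "w \<in> slit"
    by (auto simp: closed_segment_def scaleR_in_slit)
qed simp

lemma connected_slit: "connected slit"
  by (simp add: starlike_imp_connected starlike_slit)

text \<open>A word codes an iterated integral of the forms \<open>dz/(1-z)\<close> (letter \<open>True\<close>) and
  \<open>dz/z\<close> (letter \<open>False\<close>), outermost letter first. It converges at 0 iff
  the innermost letter is \<open>True\<close>, and at 1 iff moreover the outermost letter is \<open>False\<close>.\<close>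

definition letter_form :: "bool \<Rightarrow> complex \<Rightarrow> complex" where
  "letter_form b z = (if b then 1 / (1 - z) else 1 / z)"

definition convergent_word :: "bool list \<Rightarrow> bool" where
  "convergent_word w \<longleftrightarrow> w = [] \<or> last w"

definition admissible_word :: "bool list \<Rightarrow> bool" where
  "admissible_word w \<longleftrightarrow> w = [] \<or> \<not> hd w \<and> last w"

lemma convergent_word_Nil [simp]: "convergent_word []"
  by (simp add: convergent_word_def)

lemma convergent_word_Cons:
  "convergent_word (b # w) \<longleftrightarrow> (if w = [] then b else convergent_word w)"
  by (simp add: convergent_word_def)

lemma admissible_word_Nil [simp]: "admissible_word []"
  by (simp add: admissible_word_def)

lemma admissible_word_Cons:
  "admissible_word (b # w) \<longleftrightarrow> \<not> b \<and> w \<noteq> [] \<and> convergent_word w"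
  by (auto simp: admissible_word_def convergent_word_def)

lemma admissible_imp_convergent_word: "admissible_word w \<Longrightarrow> convergent_word w"
  by (auto simp: admissible_word_def convergent_word_def)

text \<open>Choice selects the primitive that vanishes at 0. It exists for convergent words; other
  words get no guaranteed value. The derivative is prescribed only away from 0, where
  \<open>letter_form False\<close> has the default value \<open>1 / 0 = 0\<close>.\<close>

fun hyperlog :: "bool list \<Rightarrow> complex \<Rightarrow> complex" where
  "hyperlog [] = (\<lambda>_. 1)"
| "hyperlog (b # w) = (SOME F. F holomorphic_on slit \<and> F 0 = 0 \<and>
     (\<forall>z\<in>slit - {0}. (F has_field_derivative letter_form b z * hyperlog w z) (at z)))"

text \<open>For dz/(1-z) the integrand is holomorphic on the slit plane. For dz/z the singularity at
  0 is removable since \<open>g 0 = 0\<close>, and the filled-in value is \<open>deriv g 0\<close>.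
  A primitive on the star-shaped domain is then normalised at 0.\<close>

lemma hyperlog_Cons_exists:
  assumes "g holomorphic_on slit" and "b \<or> g 0 = 0"
  shows "\<exists>F. F holomorphic_on slit \<and> F 0 = 0 \<and>
     (\<forall>z\<in>slit - {0}. (F has_field_derivative letter_form b z * g z) (at z))"
proof -
  obtain f where f: "f holomorphic_on slit" "\<And>z. z \<in> slit - {0} \<Longrightarrow> f z = letter_form b z * g z"
  proof (cases b)
    case True
    have "(\<lambda>z. letter_form b z * g z) holomorphic_on slit"
      unfolding letter_form_def using True assms one_notin_slit
      by (auto intro!: holomorphic_intros)
    then show ?thesis
      using that by blast
  next
    case False
    define f where "f z = (if z = 0 then deriv g 0 else g z / z)" for z
    have "f holomorphic_on slit"
      using assms(2) False
      by (intro pole_theorem_open_0[OF assms(1) open_slit, of 0]) (auto simp: f_def)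
    then show ?thesis
      using that[of f] False by (auto simp: f_def letter_form_def)
  qed
  obtain F where F: "\<forall>z\<in>slit. (F has_field_derivative f z) (at z)"
    using holomorphic_starlike_primitive[OF holomorphic_on_imp_continuous_on[OF f(1)]
        starlike_slit open_slit, of "{}"] f(1) open_slit
    by (auto simp: holomorphic_on_open field_differentiable_def)
  define G where "G z = F z - F 0" for z
  have G: "(G has_field_derivative f z) (at z)" if "z \<in> slit" for z
    unfolding G_def using F that by (auto intro!: derivative_eq_intros)
  then have "G holomorphic_on slit"
    using open_slit by (auto simp: holomorphic_on_open)
  moreover have "G 0 = 0"
    by (simp add: G_def)
  ultimately show ?thesis
    using G f(2) by (intro exI[of _ G]) (metis DiffD1)
qed

declare hyperlog.simps(2) [simp del]

lemma hyperlog_holomorphic_aux: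
  assumes "convergent_word w"
  shows "hyperlog w holomorphic_on slit \<and> (w \<noteq> [] \<longrightarrow> hyperlog w 0 = 0)"
  using assms
proof (induction w)
  case Nil
  then show ?case by simp
next
  case (Cons b w)
  then have "hyperlog w holomorphic_on slit" "b \<or> hyperlog w 0 = 0"
    by (auto simp: convergent_word_Cons split: if_splits)
  from someI_ex[OF hyperlog_Cons_exists[OF this]] show ?case
    by (simp add: hyperlog.simps(2))
qed

lemma hyperlog_holomorphic: "convergent_word w \<Longrightarrow> hyperlog w holomorphic_on slit"
  using hyperlog_holomorphic_aux by blast

lemma hyperlog_0: "convergent_word w \<Longrightarrow> w \<noteq> [] \<Longrightarrow> hyperlog w 0 = 0"
  using hyperlog_holomorphic_aux by blast

lemma hyperlog_continuous: "convergent_word w \<Longrightarrow> continuous_on slit (hyperlog w)"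
  by (simp add: hyperlog_holomorphic holomorphic_on_imp_continuous_on)

lemma hyperlog_deriv:
  assumes "convergent_word (b # w)" "z \<in> slit" "z \<noteq> 0"
  shows "(hyperlog (b # w) has_field_derivative letter_form b z * hyperlog w z) (at z)"
proof -
  have "convergent_word w" "b \<or> w \<noteq> []"
    using assms by (auto simp: convergent_word_Cons split: if_splits)
  then have "hyperlog w holomorphic_on slit" "b \<or> hyperlog w 0 = 0"
    using hyperlog_holomorphic_aux by auto
  from someI_ex[OF hyperlog_Cons_exists[OF this]] show ?thesis
    using assms by (simp add: hyperlog.simps(2))
qed

text \<open>The difference has derivative 0 off the origin and is continuous there, hence constant.
  Leaving out 0 avoids the point where dz/z is singular; the identities between hyperlogarithms and
  other functions all rest on this.\<close>

lemma primitive_unique: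
  fixes f g h :: "complex \<Rightarrow> complex"
  assumes "connected S" "open S" "0 \<in> S" "continuous_on S f" "continuous_on S g" "f 0 = g 0"
    and "\<And>z. z \<in> S - {0} \<Longrightarrow> (f has_field_derivative h z) (at z)"
    and "\<And>z. z \<in> S - {0} \<Longrightarrow> (g has_field_derivative h z) (at z)"
    and "z \<in> S"
  shows "f z = g z"
proof -
  have "((\<lambda>z. f z - g z) has_field_derivative 0) (at z)" if "z \<in> S - {0}" for z
    using DERIV_diff[OF assms(7)[OF that] assms(8)[OF that]] by simp
  moreover have "continuous_on S (\<lambda>z. f z - g z)"
    using assms by (intro continuous_intros)
  ultimately obtain c where "\<And>z. z \<in> S \<Longrightarrow> f z - g z = c"
    using DERIV_zero_connected_constant[OF assms(1,2), of "{0}" "\<lambda>z. f z - g z"] by auto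
  then show ?thesis
    using assms by (metis eq_iff_diff_eq_0)
qed

subsection \<open>The shuffle product\<close>

text \<open>A list rather than a set: an interleaving that arises in several ways must be counted
  with multiplicity.\<close>

fun shuffle_words :: "'a list \<Rightarrow> 'a list \<Rightarrow> 'a list list" where
  "shuffle_words [] v = [v]"
| "shuffle_words (a # u) [] = [a # u]"
| "shuffle_words (a # u) (b # v) =
     map ((#) a) (shuffle_words u (b # v)) @ map ((#) b) (shuffle_words (a # u) v)"

lemma shuffle_words_length:
  "w \<in> set (shuffle_words u v) \<Longrightarrow> length w = length u + length v"
  by (induction u v arbitrary: w rule: shuffle_words.induct) auto

lemma shuffle_words_convergent:
  assumes "w \<in> set (shuffle_words u v)" "convergent_word u" "convergent_word v"
  shows "convergent_word w"
  using assms
  by (induction u v arbitrary: w rule: shuffle_words.induct)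
     (force simp: convergent_word_Cons split: if_splits dest: shuffle_words_length)+

text \<open>The outermost letter of a shuffle is the outermost letter of one of the factors, so it
  remains \<open>False\<close>.\<close>

lemma shuffle_words_admissible:
  assumes "w \<in> set (shuffle_words u v)" "admissible_word u" "admissible_word v"
  shows "admissible_word w"
proof -
  have "convergent_word w"
    using assms by (meson admissible_imp_convergent_word shuffle_words_convergent)
  moreover have "w = [] \<or> \<not> hd w"
    using assms by (cases u; cases v) (auto simp: admissible_word_Cons)
  ultimately show ?thesis
    by (auto simp: convergent_word_def admissible_word_def)
qed

lemma sum_list_continuous_on:
  fixes f :: "'b \<Rightarrow> 'a::topological_space \<Rightarrow> 'c::real_normed_vector"
  assumes "\<And>w. w \<in> set ws \<Longrightarrow> continuous_on S (f w)"
  shows "continuous_on S (\<lambda>z. \<Sum>w\<leftarrow>ws. f w z)"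
  using assms by (induction ws) (auto intro!: continuous_intros)

lemma sum_list_map_eq_0:
  "(\<And>w. w \<in> set ws \<Longrightarrow> f w = 0) \<Longrightarrow> (\<Sum>w\<leftarrow>ws. f w) = (0::'a::monoid_add)"
  by (induction ws) auto

lemma sum_list_has_field_derivative:
  fixes f :: "'b \<Rightarrow> complex \<Rightarrow> complex"
  assumes "\<And>w. w \<in> set ws \<Longrightarrow> (f w has_field_derivative f' w) F"
  shows "((\<lambda>z. \<Sum>w\<leftarrow>ws. f w z) has_field_derivative (\<Sum>w\<leftarrow>ws. f' w)) F"
  using assms by (induction ws) (auto intro!: derivative_eq_intros)

text \<open>Both sides vanish at 0 when the words are nonempty. By the product rule the derivative
  strips the outermost letter of either factor, which is the recursion of the shuffle; the induction
  hypotheses and uniqueness of primitives finish.\<close>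

theorem hyperlog_shuffle:
  assumes "convergent_word u" "convergent_word v" "z \<in> slit"
  shows "hyperlog u z * hyperlog v z = (\<Sum>w\<leftarrow>shuffle_words u v. hyperlog w z)"
  using assms
proof (induction u v arbitrary: z rule: shuffle_words.induct)
  case (3 a u b v)
  have conv: "convergent_word u" "convergent_word v"
    using "3.prems" by (auto simp: convergent_word_Cons split: if_splits)
  have cw: "convergent_word (a # w)" if "w \<in> set (shuffle_words u (b # v))" for w
  proof -
    have "a # w \<in> set (shuffle_words (a # u) (b # v))"
      using that by simp
    then show ?thesis
      using "3.prems" by (blast intro: shuffle_words_convergent)
  qed
  have cw': "convergent_word (b # w)" if "w \<in> set (shuffle_words (a # u) v)" for w
  proof -
    have "b # w \<in> set (shuffle_words (a # u) (b # v))"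
      using that by simp
    then show ?thesis
      using "3.prems" by (blast intro: shuffle_words_convergent)
  qed
  define h where "h z = letter_form a z * hyperlog u z * hyperlog (b # v) z +
    hyperlog (a # u) z * (letter_form b z * hyperlog v z)" for z
  define R where "R z = (\<Sum>w\<leftarrow>shuffle_words u (b # v). hyperlog (a # w) z) +
    (\<Sum>w\<leftarrow>shuffle_words (a # u) v. hyperlog (b # w) z)" for z
  have "hyperlog (a # u) z * hyperlog (b # v) z = R z"
  proof (rule primitive_unique[OF connected_slit open_slit zero_in_slit,
        where f = "\<lambda>z. hyperlog (a # u) z * hyperlog (b # v) z" and g = R and h = h])
    show "continuous_on slit (\<lambda>z. hyperlog (a # u) z * hyperlog (b # v) z)"
      using "3.prems" by (intro continuous_intros hyperlog_continuous)
    show "continuous_on slit R"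
      unfolding R_def
      by (intro continuous_intros sum_list_continuous_on hyperlog_continuous cw cw')
    have "(\<Sum>w\<leftarrow>shuffle_words u (b # v). hyperlog (a # w) 0) = 0"
      using cw by (intro sum_list_map_eq_0) (auto simp: hyperlog_0)
    moreover have "(\<Sum>w\<leftarrow>shuffle_words (a # u) v. hyperlog (b # w) 0) = 0"
      using cw' by (intro sum_list_map_eq_0) (auto simp: hyperlog_0)
    ultimately show "hyperlog (a # u) 0 * hyperlog (b # v) 0 = R 0"
      using "3.prems" by (simp add: R_def hyperlog_0)
    fix z assume z: "z \<in> slit - {0}"
    show "((\<lambda>z. hyperlog (a # u) z * hyperlog (b # v) z) has_field_derivative h z) (at z)"
      using "3.prems" z unfolding h_def
      by (auto intro!: derivative_eq_intros hyperlog_deriv simp: algebra_simps)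
    have "h z = letter_form a z * (hyperlog u z * hyperlog (b # v) z) +
        letter_form b z * (hyperlog (a # u) z * hyperlog v z)"
      by (simp add: h_def)
    also have "\<dots> = (\<Sum>w\<leftarrow>shuffle_words u (b # v). letter_form a z * hyperlog w z) +
        (\<Sum>w\<leftarrow>shuffle_words (a # u) v. letter_form b z * hyperlog w z)"
      using "3.IH"(1)[of z] "3.IH"(2)[of z] conv "3.prems" z
      by (simp add: sum_list_const_mult)
    finally have "h z = \<dots>" .
    moreover have "(R has_field_derivative
        ((\<Sum>w\<leftarrow>shuffle_words u (b # v). letter_form a z * hyperlog w z) +
        (\<Sum>w\<leftarrow>shuffle_words (a # u) v. letter_form b z * hyperlog w z))) (at z)"
      unfolding R_def using z
      by (intro DERIV_add sum_list_has_field_derivative hyperlog_deriv cw cw') auto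
    ultimately show "(R has_field_derivative h z) (at z)"
      by simp
  qed (use 3 in auto)
  then show ?case
    by (simp add: R_def o_def)
qed auto

subsection \<open>Power series and convergence on the closed disc\<close>

text \<open>The Taylor coefficients at 0: multiplying by 1/(1-z) forms partial sums, and integration
  divides by \<open>n\<close> while shifting the index, hence \<open>j < n\<close>. At
  \<open>n = 0\<close> the division by zero yields 0, the correct constant term.\<close>

fun word_coeff :: "bool list \<Rightarrow> nat \<Rightarrow> real" where
  "word_coeff [] n = (if n = 0 then 1 else 0)"
| "word_coeff (b # w) n = (if b then (\<Sum>j<n. word_coeff w j) else word_coeff w n) / real n"

section \<open>Growth of the Taylor coefficients\<close>

lemma word_coeff_nonneg: "0 \<le> word_coeff w n"
  by (induction w n rule: word_coeff.induct) (auto intro!: divide_nonneg_nonneg sum_nonneg)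

lemma word_coeff_0: "w \<noteq> [] \<Longrightarrow> word_coeff w 0 = 0"
  by (cases w) auto

lemma word_coeff_False_le: "word_coeff (False # w) n \<le> word_coeff w n"
proof (cases "n = 0")
  case False
  then show ?thesis
    using word_coeff_nonneg[of w n] mult_left_mono[of 1 "real n" "word_coeff w n"]
    by (simp add: divide_le_eq)
qed (simp add: word_coeff_nonneg)

lemma word_coeff_le_1: "word_coeff w n \<le> 1"
proof (induction w arbitrary: n)
  case (Cons b w)
  show ?case
  proof (cases b)
    case True
    have "(\<Sum>j<n. word_coeff w j) \<le> real n"
      using sum_mono[of "{..<n}" "word_coeff w" "\<lambda>_. 1"] Cons by simp
    then show ?thesis
      using True by (cases "n = 0") (auto simp: divide_le_eq)
  next
    case False
    then show ?thesis
      using order_trans[OF word_coeff_False_le[of w n] Cons[of n]] by simp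
  qed
qed simp

text \<open>Telescoping: with \<open>s\<close> and \<open>t\<close> the roots of n+1 and n, the
  square of \<open>s - t\<close> being nonnegative gives \<open>1 / s \<le> 2 * s - 2 * t\<close>.
  The term \<open>j = 0\<close> is 0 by convention.\<close>

lemma sum_inverse_sqrt_le: "(\<Sum>j<n. 1 / sqrt (real j)) \<le> 2 * sqrt (real n)"
proof -
  have "(\<Sum>j\<le>n. 1 / sqrt (real j)) \<le> 2 * sqrt (real n)"
  proof (induction n)
    case (Suc n)
    define s t where "s = sqrt (real (Suc n))" and "t = sqrt (real n)"
    have "s > 0" "s * s = t * t + 1"
      by (simp_all add: s_def t_def)
    moreover have "0 \<le> (s - t) * (s - t)"
      by simp
    ultimately have "1 / s \<le> 2 * s - 2 * t"
      by (subst pos_divide_le_eq) (simp_all add: algebra_simps)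
    then show ?case
      using Suc by (simp add: s_def t_def)
  qed simp
  then show ?thesis
    by (simp flip: lessThan_Suc_atMost) (smt (verit) real_sqrt_ge_zero divide_nonneg_nonneg of_nat_0_le_iff)
qed

text \<open>A square-root bound is crude but stable under induction: the letter \<open>True\<close>
  turns a bound C sqrt(j) on partial sums into C/sqrt(j) for single coefficients, whose sum is at
  most 2C sqrt(n); the letter \<open>False\<close> only shrinks coefficients.\<close>

lemma word_coeff_sum_le: "(\<Sum>j<n. word_coeff w j) \<le> 2 ^ length w * sqrt (real n)"
proof (induction w arbitrary: n)
  case Nil
  have "(\<Sum>j<n. word_coeff [] j) \<le> (if n = 0 then 0 else 1)"
    by (simp add: sum.If_cases)
  also have "\<dots> \<le> sqrt (real n)"
    by simp
  finally show ?case by simp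
next
  case (Cons b w)
  have le: "word_coeff (b # w) j \<le> 2 ^ length w * (1 / sqrt (real j))" if b for j
  proof (cases "j = 0")
    case False
    have "word_coeff (b # w) j \<le> 2 ^ length w * sqrt (real j) / real j"
      using Cons[of j] that by (simp add: divide_right_mono)
    also have "\<dots> = 2 ^ length w * (1 / sqrt (real j))"
      using False by (simp add: field_simps)
    finally show ?thesis .
  qed (use that in simp)
  show ?case
  proof (cases b)
    case True
    have "(\<Sum>j<n. word_coeff (b # w) j) \<le> (\<Sum>j<n. 2 ^ length w * (1 / sqrt (real j)))"
      by (intro sum_mono le True)
    also have "\<dots> = 2 ^ length w * (\<Sum>j<n. 1 / sqrt (real j))"
      by (simp add: sum_distrib_left)
    also have "\<dots> \<le> 2 ^ length w * (2 * sqrt (real n))"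
      by (intro mult_left_mono sum_inverse_sqrt_le) simp
    finally show ?thesis
      by simp
  next
    case False
    have "(\<Sum>j<n. word_coeff (b # w) j) \<le> (\<Sum>j<n. word_coeff w j)"
      using False word_coeff_False_le by (intro sum_mono) auto
    also have "\<dots> \<le> 2 ^ length w * sqrt (real n)"
      by (rule Cons)
    also have "\<dots> \<le> 2 ^ length (b # w) * sqrt (real n)"
      by (simp add: mult_right_mono)
    finally show ?thesis .
  qed
qed

lemma word_coeff_le:
  assumes "w \<noteq> []"
  shows "word_coeff w n \<le> 2 ^ length w / sqrt (real n)"
  using assms
proof (induction w)
  case (Cons b w)
  show ?case
  proof (cases "n = 0")
    case False
    show ?thesis
    proof (cases b)
      case True
      have "word_coeff (b # w) n \<le> 2 ^ length w * sqrt (real n) / real n"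
        using word_coeff_sum_le[of w n] True by (simp add: divide_right_mono)
      also have "\<dots> = 2 ^ length w / sqrt (real n)"
        using False by (simp add: field_simps)
      also have "\<dots> \<le> 2 ^ length (b # w) / sqrt (real n)"
        by (simp add: divide_right_mono)
      finally show ?thesis .
    next
      case b: False
      show ?thesis
      proof (cases "w = []")
        case w: False
        have "word_coeff (b # w) n \<le> word_coeff w n"
          using b word_coeff_False_le[of w n] by simp
        also have "\<dots> \<le> 2 ^ length w / sqrt (real n)"
          using w Cons by simp
        also have "\<dots> \<le> 2 ^ length (b # w) / sqrt (real n)"
          by (simp add: divide_right_mono)
        finally show ?thesis .
      qed (use b False in simp)
    qed
  qed simp
qed simp

text \<open>The outermost \<open>False\<close> contributes a further factor 1/n to the bound of
  order 1/sqrt(n), so the coefficients are of order n to the power -3/2.\<close>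

lemma word_coeff_summable:
  assumes "admissible_word w"
  shows "summable (word_coeff w)"
proof (cases w)
  case Nil
  then show ?thesis
    by (intro summable_finite[of "{0}"]) auto
next
  case (Cons b v)
  then have v: "\<not> b" "v \<noteq> []"
    using assms by (auto simp: admissible_word_Cons)
  have "summable (\<lambda>n. 2 ^ length v * real n powr (- (3/2)))"
    by (intro summable_mult) (simp add: summable_real_powr_iff)
  moreover have "norm (word_coeff w n) \<le> 2 ^ length v * real n powr (- (3/2))" for n
  proof (cases "n = 0")
    case False
    have "word_coeff w n \<le> 2 ^ length v / sqrt (real n) / real n"
      using divide_right_mono[OF word_coeff_le[OF v(2), of n], of "real n"] v Cons by simp
    also have "\<dots> = 2 ^ length v * real n powr (- (3/2))"
      using False powr_add[of "real n" "-1/2" "-1"]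
      by (simp add: powr_minus powr_half_sqrt field_simps)
    finally show ?thesis
      by (simp add: word_coeff_nonneg)
  qed (simp add: Cons word_coeff_0)
  ultimately show ?thesis
    by (rule summable_comparison_test'[where N = 0])
qed

text \<open>Complements \<open>hyperlog\<close>: for admissible words it makes sense on the whole
  closed disc, in particular at 1, which lies outside \<open>slit\<close> and is the value of
  \<open>cis\<close> at both ends of a period.\<close>

definition word_series :: "bool list \<Rightarrow> complex \<Rightarrow> complex" where
  "word_series w z = (\<Sum>n. of_real (word_coeff w n) * z ^ n)"

section \<open>Word series in the disc and on its boundary\<close>

lemma word_series_Nil: "word_series [] z = 1"
proof -
  have "(\<lambda>n. of_real (word_coeff [] n) * z ^ n) sums (\<Sum>n\<in>{0}. of_real (word_coeff [] n) * z ^ n)"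
    by (rule sums_finite) auto
  then show ?thesis
    by (simp add: word_series_def sums_iff)
qed

lemma word_series_summable_ball:
  assumes "norm z < 1"
  shows "summable (\<lambda>n. norm (of_real (word_coeff w n) * z ^ n :: complex))"
proof (rule summable_comparison_test'[where N = 0])
  show "summable (\<lambda>n. norm z ^ n)"
    using assms by simp
  show "norm (norm (of_real (word_coeff w n) * z ^ n :: complex)) \<le> norm z ^ n" for n
    using word_coeff_le_1[of w n] word_coeff_nonneg[of w n]
    by (simp add: norm_mult norm_power mult_left_le_one_le)
qed

text \<open>The nonnegative summable coefficients are themselves the majorant in the Weierstrass
  test.\<close>

lemma word_series_continuous_cball:
  assumes "admissible_word w"
  shows "continuous_on (cball 0 1) (word_series w)"
proof (rule uniform_limit_theorem)
  show "uniform_limit (cball 0 1) (\<lambda>n z. \<Sum>i<n. of_real (word_coeff w i) * z ^ i)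
      (word_series w) sequentially"
    unfolding word_series_def
  proof (rule Weierstrass_m_test)
    show "summable (word_coeff w)"
      by (rule word_coeff_summable[OF assms])
    show "norm (complex_of_real (word_coeff w n) * z ^ n) \<le> word_coeff w n"
      if "z \<in> cball 0 1" for n z
      using that word_coeff_nonneg[of w n]
      by (simp add: norm_mult norm_power mult_left_le power_le_one)
  qed
qed (auto intro!: continuous_intros always_eventually)

text \<open>Termwise differentiation. For \<open>True\<close> the result is the Cauchy product with
  the geometric series, for \<open>False\<close> it is the series divided by
  \<open>z\<close>.\<close>

lemma word_series_deriv:
  assumes "norm z < 1" "z \<noteq> 0" "b \<or> w \<noteq> []"
  shows "(word_series (b # w) has_field_derivative letter_form b z * word_series w z) (at z)"
proof -
  define c :: "nat \<Rightarrow> complex" where "c n = of_real (word_coeff (b # w) n)" for n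
  have "(word_series (b # w) has_field_derivative (\<Sum>n. diffs c n * z ^ n)) (at z)"
    unfolding word_series_def[abs_def] c_def
    by (rule termdiffs_strong'[OF summable_norm_cancel[OF word_series_summable_ball] assms(1)])
  moreover have "(\<Sum>n. diffs c n * z ^ n) = letter_form b z * word_series w z"
  proof (cases b)
    case True
    have "summable (\<lambda>n. norm (z ^ n))"
      using assms by (simp add: norm_power)
    from Cauchy_product_sums[OF word_series_summable_ball[OF assms(1), of w] this]
    have "(\<lambda>k. \<Sum>i\<le>k. of_real (word_coeff w i) * z ^ i * z ^ (k - i)) sums
        (word_series w z * (1 / (1 - z)))"
      using assms(1) by (simp add: word_series_def suminf_geometric)
    \<comment> \<open>The index shift in \<open>diffs\<close> matches: k+1 times the coefficient of
      order k+1 is the sum over \<open>j < k + 1\<close>, that is over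
      \<open>i \<le> k\<close>.\<close>
    moreover have "(\<Sum>i\<le>k. of_real (word_coeff w i) * z ^ i * z ^ (k - i)) = diffs c k * z ^ k" for k
    proof -
      have "(\<Sum>i\<le>k. of_real (word_coeff w i) * z ^ i * z ^ (k - i)) =
          (\<Sum>i\<le>k. of_real (word_coeff w i)) * z ^ k"
        unfolding sum_distrib_right
        by (intro sum.cong refl) (simp flip: power_add)
      also have "(\<Sum>i\<le>k. complex_of_real (word_coeff w i)) = diffs c k"
        using True by (simp add: diffs_def c_def lessThan_Suc_atMost del: of_nat_Suc)
      finally show ?thesis .
    qed
    ultimately show ?thesis
      using True by (simp add: letter_form_def sums_iff mult.commute)
  next
    case False
    have "diffs c n = of_real (word_coeff w (Suc n))" for n
      using False by (simp add: c_def diffs_def del: of_nat_Suc)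
    moreover have "summable (\<lambda>n. of_real (word_coeff w n) * z ^ n)"
      using word_series_summable_ball[OF assms(1)] by (rule summable_norm_cancel)
    \<comment> \<open>The head split off here is the constant coefficient, which vanishes because
      \<open>w\<close> is nonempty.\<close>
    ultimately have "word_series w z = (\<Sum>n. diffs c n * z ^ n) * z"
      using powser_split_head(1)[of "\<lambda>n. of_real (word_coeff w n)" z] False assms(3)
      by (simp add: word_series_def word_coeff_0)
    then show ?thesis
      using False assms(2) by (simp add: letter_form_def)
  qed
  ultimately show ?thesis
    by simp
qed

theorem hyperlog_eq_word_series_ball:
  assumes "convergent_word w" "norm z < 1"
  shows "hyperlog w z = word_series w z"
  using assms
proof (induction w arbitrary: z)
  case Nil
  then show ?case
    by (simp add: word_series_Nil)
next
  case (Cons b w)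
  have w: "convergent_word w" "b \<or> w \<noteq> []"
    using Cons.prems by (auto simp: convergent_word_Cons split: if_splits)
  have ser: "(word_series (b # w) has_field_derivative letter_form b z * hyperlog w z) (at z)"
    if "z \<in> ball 0 1 - {0}" for z
    using word_series_deriv[of z b w] that w Cons.IH[of z] by simp
  show ?case
  proof (rule primitive_unique[where S = "ball 0 1" and f = "hyperlog (b # w)" and
        g = "word_series (b # w)" and h = "\<lambda>z. letter_form b z * hyperlog w z"])
    show "continuous_on (ball 0 1) (hyperlog (b # w))"
      using hyperlog_continuous[OF Cons.prems(1)] ball_subset_slit by (rule continuous_on_subset)
    show "continuous_on (ball 0 1) (word_series (b # w))"
    proof (intro continuous_at_imp_continuous_on ballI)
      fix z :: complex
      assume "z \<in> ball 0 1"
      then show "isCont (word_series (b # w)) z"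
        unfolding word_series_def[abs_def]
        by (intro DERIV_isCont[OF termdiffs_strong'[where K = 1]]
            summable_norm_cancel[OF word_series_summable_ball]) auto
    qed
    show "hyperlog (b # w) 0 = word_series (b # w) 0"
      using powser_zero[of "\<lambda>n. of_real (word_coeff (b # w) n)"]
      by (simp add: hyperlog_0[OF Cons.prems(1)] word_series_def del: word_coeff.simps)
        (simp add: word_coeff_0 del: word_coeff.simps)
    show "(hyperlog (b # w) has_field_derivative letter_form b z * hyperlog w z) (at z)"
      if "z \<in> ball 0 1 - {0}" for z
      using that ball_subset_slit by (intro hyperlog_deriv[OF Cons.prems(1)]) auto
  qed (use Cons.prems ser in auto)
qed

text \<open>Abel-style passage to the boundary: identities known in the open disc are carried to the
  circle along radii.\<close>

lemma tendsto_radial_1: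
  fixes f :: "complex \<Rightarrow> complex"
  assumes "continuous_on (cball 0 1) f" "norm z \<le> 1"
  shows "((\<lambda>r. f (of_real r * z)) \<longlongrightarrow> f z) (at_left 1)"
proof -
  have "((\<lambda>r. of_real r * z) \<longlongrightarrow> of_real 1 * z) (at_left 1)"
    by (intro tendsto_intros)
  moreover have "eventually (\<lambda>r. of_real r * z \<in> cball 0 1) (at_left (1::real))"
    using eventually_at_left_real[of 0 "1::real", OF zero_less_one]
  proof eventually_elim
    case (elim r)
    then show ?case
      using assms(2) by (simp add: norm_mult mult_le_one)
  qed
  ultimately show ?thesis
    using continuous_on_tendsto_compose[OF assms(1), of "\<lambda>r. of_real r * z" z "at_left 1"] assms(2)
    by simp
qed

theorem hyperlog_eq_word_series:
  assumes "admissible_word w" "norm z \<le> 1" "z \<in> slit"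
  shows "hyperlog w z = word_series w z"
proof -
  have conv: "convergent_word w"
    using assms(1) by (rule admissible_imp_convergent_word)
  have lim: "((\<lambda>r. word_series w (of_real r * z)) \<longlongrightarrow> word_series w z) (at_left 1)"
    by (intro tendsto_radial_1 word_series_continuous_cball assms)
  have "eventually (\<lambda>r. hyperlog w (of_real r * z) = word_series w (of_real r * z)) (at_left 1)"
    using eventually_at_left_real[of 0 "1::real", OF zero_less_one]
  proof eventually_elim
    case (elim r)
    then have "r * norm z \<le> r * 1"
      using assms(2) by (intro mult_left_mono) auto
    also have "\<dots> < 1"
      using elim by simp
    finally have "norm (of_real r * z) < 1"
      using elim by (simp add: norm_mult)
    then show ?case
      using hyperlog_eq_word_series_ball[OF conv] by simp
  qed
  then have "((\<lambda>r. hyperlog w (of_real r * z)) \<longlongrightarrow> word_series w z) (at_left 1)"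
    by (rule tendsto_cong[THEN iffD2, OF _ lim])
  moreover have "((\<lambda>r. hyperlog w (of_real r * z)) \<longlongrightarrow> hyperlog w z) (at_left 1)"
  proof -
    have "isCont (hyperlog w) z"
      using hyperlog_continuous[OF conv] open_slit assms(3)
      by (simp add: continuous_on_eq_continuous_at)
    moreover have "((\<lambda>r. of_real r * z) \<longlongrightarrow> of_real 1 * z) (at_left 1)"
      by (intro tendsto_intros)
    ultimately show ?thesis
      using isCont_tendsto_compose[of z "hyperlog w" "\<lambda>r. of_real r * z" "at_left 1"] by simp
  qed
  ultimately show ?thesis
    using tendsto_unique[OF trivial_limit_at_left_real] by blast
qed

theorem word_series_shuffle_1:
  assumes "admissible_word u" "admissible_word v"
  shows "word_series u 1 * word_series v 1 = (\<Sum>w\<leftarrow>shuffle_words u v. word_series w 1)"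
proof -
  have adm: "admissible_word w" if "w \<in> set (shuffle_words u v)" for w
    using that assms shuffle_words_admissible by blast
  have "((\<lambda>r. word_series u (of_real r * 1) * word_series v (of_real r * 1)) \<longlongrightarrow>
      word_series u 1 * word_series v 1) (at_left 1)" (is "(?f \<longlongrightarrow> _) _")
    by (intro tendsto_mult tendsto_radial_1 word_series_continuous_cball assms) auto
  moreover have lim: "((\<lambda>r. (\<lambda>z. \<Sum>w\<leftarrow>shuffle_words u v. word_series w z) (of_real r * 1)) \<longlongrightarrow>
      (\<Sum>w\<leftarrow>shuffle_words u v. word_series w 1)) (at_left 1)"
    by (intro tendsto_radial_1 sum_list_continuous_on word_series_continuous_cball adm) auto
  moreover have "eventually (\<lambda>r. word_series u (of_real r * 1) * word_series v (of_real r * 1) =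
      (\<Sum>w\<leftarrow>shuffle_words u v. word_series w (of_real r * 1))) (at_left 1)"
    using eventually_at_left_real[of 0 "1::real", OF zero_less_one]
  proof eventually_elim
    case (elim r)
    define z :: complex where "z = of_real r * 1"
    have z: "norm z < 1" "z \<in> slit"
      using elim ball_subset_slit by (auto simp: z_def)
    have "(\<Sum>w\<leftarrow>shuffle_words u v. word_series w z) = (\<Sum>w\<leftarrow>shuffle_words u v. hyperlog w z)"
      using adm z(1) by (intro arg_cong[of _ _ sum_list] map_cong refl)
        (simp add: hyperlog_eq_word_series_ball admissible_imp_convergent_word)
    then have "word_series u z * word_series v z = (\<Sum>w\<leftarrow>shuffle_words u v. word_series w z)"
      using hyperlog_shuffle[of u v z] assms z
      by (simp add: hyperlog_eq_word_series_ball admissible_imp_convergent_word)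
    then show ?case
      unfolding z_def .
  qed
  then have "(?f \<longlongrightarrow> (\<Sum>w\<leftarrow>shuffle_words u v. word_series w 1)) (at_left 1)"
    by (rule tendsto_cong[THEN iffD2, OF _ lim])
  ultimately show ?thesis
    using tendsto_unique[OF trivial_limit_at_left_real] by blast
qed

subsection \<open>Multiple polylogarithms as hyperlogarithms\<close>

text \<open>An entry \<open>k\<close> becomes a block of k-1 letters \<open>False\<close> followed
  by \<open>True\<close>, and the last entry gives the outermost block. Since \<open>k - 1\<close>
  truncates, 0 and 1 have the same code, whence the positivity conditions below.\<close>

definition index_word :: "nat list \<Rightarrow> bool list" where
  "index_word as = foldl (\<lambda>w k. replicate (k - 1) False @ True # w) [] as"

lemma index_word_Nil [simp]: "index_word [] = []"
  by (simp add: index_word_def)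

lemma index_word_snoc: "index_word (as @ [k]) = replicate (k - 1) False @ True # index_word as"
  by (simp add: index_word_def)

lemma index_word_convergent: "convergent_word (index_word as)"
proof (induction as rule: rev_induct)
  case (snoc k as)
  then show ?case
    by (auto simp: index_word_snoc convergent_word_def)
qed simp

lemma index_word_admissible:
  assumes "admissible as"
  shows "admissible_word (index_word as)"
proof (cases as rule: rev_cases)
  case (snoc bs k)
  then have "k \<ge> 2"
    using assms by (simp add: admissible_def)
  then have "k - 1 = Suc (k - 2)"
    by simp
  then have "hd (index_word as) = False" "index_word as \<noteq> []"
    by (auto simp: snoc index_word_snoc)
  then show ?thesis
    using index_word_convergent[of as] by (simp add: admissible_word_def convergent_word_def)
qed simp

text \<open>Reading the word from its innermost letter outwards, \<open>True\<close> appends an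
  entry 1 and \<open>False\<close> raises the last entry by 1.\<close>

lemma convergent_word_imp_index:
  assumes "convergent_word w"
  shows "\<exists>as. index_word as = w \<and> (\<forall>a\<in>set as. 1 \<le> a)"
  using assms
proof (induction w)
  case Nil
  then show ?case
    by (intro exI[of _ "[]"]) simp
next
  case (Cons b w)
  then obtain as where as: "index_word as = w" "\<forall>a\<in>set as. 1 \<le> a"
    by (auto simp: convergent_word_Cons split: if_splits)
  show ?case
  proof (cases b)
    case True
    then show ?thesis
      using as by (intro exI[of _ "as @ [1]"]) (simp add: index_word_snoc)
  next
    case False
    then have "as \<noteq> []"
      using Cons.prems as by (auto simp: convergent_word_Cons)
    then obtain bs k where bs: "as = bs @ [k]"
      by (cases as rule: rev_cases) auto
    have "k = Suc (k - 1)"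
      using as(2) bs by simp
    then have "index_word (bs @ [Suc k]) = False # index_word as"
      unfolding bs index_word_snoc by (metis append_Cons diff_Suc_1 replicate_Suc)
    then show ?thesis
      using False as bs by (intro exI[of _ "bs @ [Suc k]"]) simp
  qed
qed

text \<open>A last entry equal to 1 would make the word begin with \<open>True\<close>.\<close>

lemma admissible_word_imp_index:
  assumes "admissible_word w"
  shows "\<exists>as. index_word as = w \<and> admissible as"
proof -
  obtain as where as: "index_word as = w" "\<forall>a\<in>set as. 1 \<le> a"
    using assms admissible_imp_convergent_word convergent_word_imp_index by blast
  have "2 \<le> last as" if ne: "as \<noteq> []"
  proof -
    obtain bs k where bs: "as = bs @ [k]"
      using ne by (cases as rule: rev_cases) auto
    have "k \<noteq> 1"
      using assms as(1) by (auto simp: bs index_word_snoc admissible_word_def)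
    then show ?thesis
      using as(2) bs by auto
  qed
  then show ?thesis
    using as by (auto simp: admissible_def)
qed

section \<open>Taylor coefficients as sums over increasing tuples\<close>

lemma word_coeff_replicate_False:
  "word_coeff (replicate j False @ w) n = word_coeff w n / real n ^ j"
  by (induction j) (auto simp: field_simps)

lemma word_coeff_index_snoc:
  assumes "1 \<le> k"
  shows "word_coeff (index_word (as @ [k])) n =
    (\<Sum>j<n. word_coeff (index_word as) j) / real n ^ k"
proof -
  have "real n ^ k = real n * real n ^ (k - 1)"
    using assms by (simp flip: power_Suc)
  then show ?thesis
    by (simp add: index_word_snoc word_coeff_replicate_False)
qed

text \<open>Slices the tuples by their largest entry. The prepended 0 puts the empty tuple in the
  slice \<open>n = 0\<close>, in agreement with \<open>word_coeff []\<close>.\<close>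

definition incr_fiber :: "nat \<Rightarrow> nat \<Rightarrow> nat list set" where
  "incr_fiber r n = {ms \<in> incr_tuples r. last (0 # ms) = n}"

lemma incr_fiber_0: "incr_fiber 0 n = (if n = 0 then {[]} else {})"
  by (auto simp: incr_fiber_def incr_tuples_def)

lemma sorted_less_le_last:
  "sorted_wrt (<) ms \<Longrightarrow> m \<in> set ms \<Longrightarrow> m \<le> last (0 # (ms :: nat list))"
  by (cases ms rule: rev_cases) (auto simp: sorted_wrt_append intro: less_imp_le)

lemma incr_fiber_Suc: "incr_fiber (Suc r) n = (\<lambda>ms. ms @ [n]) ` (\<Union>j<n. incr_fiber r j)"
proof (intro set_eqI iffI)
  fix ms
  assume ms: "ms \<in> incr_fiber (Suc r) n"
  then obtain ys x where ys: "ms = ys @ [x]"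
    by (cases ms rule: rev_cases) (auto simp: incr_fiber_def incr_tuples_def)
  have "x = n" "ys \<in> incr_tuples r" "last (0 # ys) < n"
    using ms by (auto simp: ys incr_fiber_def incr_tuples_def sorted_wrt_append)
  then show "ms \<in> (\<lambda>ms. ms @ [n]) ` (\<Union>j<n. incr_fiber r j)"
    by (auto simp: ys incr_fiber_def)
next
  fix ms
  assume "ms \<in> (\<lambda>ms. ms @ [n]) ` (\<Union>j<n. incr_fiber r j)"
  then obtain ys where ys: "ms = ys @ [n]" "ys \<in> incr_tuples r" "last (0 # ys) < n"
    by (auto simp: incr_fiber_def)
  then have "\<forall>y\<in>set ys. y < n"
    using sorted_less_le_last[of ys] by (fastforce simp: incr_tuples_def)
  then show "ms \<in> incr_fiber (Suc r) n"
    using ys by (auto simp: incr_fiber_def incr_tuples_def sorted_wrt_append)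
qed

lemma finite_incr_fiber: "finite (incr_fiber r n)"
  by (induction r arbitrary: n) (auto simp: incr_fiber_0 incr_fiber_Suc)

lemma incr_fiber_disjoint: "i \<noteq> j \<Longrightarrow> incr_fiber r i \<inter> incr_fiber r j = {}"
  by (auto simp: incr_fiber_def)

text \<open>Removing the largest entry \<open>n\<close> leaves a tuple in a slice
  \<open>j < n\<close> and a factor \<open>1 / n ^ k\<close>, which is the recursion of
  \<open>word_coeff\<close> across one block.\<close>

lemma sum_incr_fiber:
  assumes "\<forall>a\<in>set as. 1 \<le> a"
  shows "(\<Sum>ms\<in>incr_fiber (length as) n. 1 / (\<Prod>j<length as. real (ms ! j) ^ (as ! j))) =
    word_coeff (index_word as) n"
  using assms
proof (induction as arbitrary: n rule: rev_induct)
  case (snoc k as)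
  define W where "W as ms = 1 / (\<Prod>j<length as. real (ms ! j) ^ (as ! j))" for as ms :: "nat list"
  have W: "W (as @ [k]) (ms @ [n]) = W as ms / real n ^ k" if "ms \<in> incr_fiber (length as) j" for ms j
  proof -
    have len: "length ms = length as"
      using that by (simp add: incr_fiber_def incr_tuples_def)
    have "(\<Prod>j<length as. real ((ms @ [n]) ! j) ^ ((as @ [k]) ! j)) =
        (\<Prod>j<length as. real (ms ! j) ^ (as ! j))"
      by (intro prod.cong refl) (simp add: nth_append len)
    then show ?thesis
      by (simp add: W_def len nth_append)
  qed
  have "(\<Sum>ms\<in>incr_fiber (length (as @ [k])) n. W (as @ [k]) ms) =
      (\<Sum>ms\<in>(\<Union>j<n. incr_fiber (length as) j). W (as @ [k]) (ms @ [n]))"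
    by (simp add: incr_fiber_Suc sum.reindex inj_on_def)
  also have "\<dots> = (\<Sum>j<n. \<Sum>ms\<in>incr_fiber (length as) j. W (as @ [k]) (ms @ [n]))"
    by (intro sum.UNION_disjoint) (auto simp: finite_incr_fiber incr_fiber_disjoint)
  also have "\<dots> = (\<Sum>j<n. \<Sum>ms\<in>incr_fiber (length as) j. W as ms / real n ^ k)"
    by (intro sum.cong refl W)
  also have "\<dots> = (\<Sum>j<n. word_coeff (index_word as) j) / real n ^ k"
    using snoc unfolding W_def sum_divide_distrib[symmetric] by simp
  finally show ?case
    using snoc.prems by (simp add: W_def word_coeff_index_snoc)
qed (simp add: incr_fiber_0)

text \<open>Summing first over each finite slice turns the multiple sum into the power series. The
  rearrangement is justified by absolute summability, which reduces to the nonnegative terms at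
  \<open>z = 1\<close>.\<close>

theorem mpolylog_has_sum:
  assumes "admissible as" "norm z \<le> 1" "as \<noteq> []"
  shows "((\<lambda>ms. z ^ last ms / (\<Prod>j<length as. of_nat (ms ! j) ^ (as ! j))) has_sum
      word_series (index_word as) z) (incr_tuples (length as))"
proof -
  have as: "\<forall>a\<in>set as. 1 \<le> a"
    using assms by (simp add: admissible_def)
  have smm: "summable (word_coeff (index_word as))"
    using assms by (intro word_coeff_summable index_word_admissible)
  define r where "r = length as"
  define W where "W ms = 1 / (\<Prod>j<length as. real (ms ! j) ^ (as ! j))" for ms :: "nat list"
  have W_nonneg: "W ms \<ge> 0" for ms
    unfolding W_def by (intro divide_nonneg_nonneg prod_nonneg) auto
  have W_sum: "(\<Sum>ms\<in>incr_fiber r n. W ms) = word_coeff (index_word as) n" for n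
    unfolding r_def W_def by (rule sum_incr_fiber[OF as])
  \<comment> \<open>Pairing a tuple with its largest entry identifies the tuples with the disjoint
    union of the slices.\<close>
  have bij: "bij_betw snd (Sigma UNIV (incr_fiber r)) (incr_tuples r)"
    by (rule bij_betwI[where g = "\<lambda>ms. (last (0 # ms), ms)"]) (auto simp: incr_fiber_def)
  have "(\<lambda>(n, ms). W ms) summable_on Sigma UNIV (incr_fiber r)"
  proof (rule summable_on_SigmaI)
    show "((\<lambda>ms. case (n, ms) of (n, ms) \<Rightarrow> W ms) has_sum word_coeff (index_word as) n) (incr_fiber r n)" for n
      by (intro has_sum_finiteI finite_incr_fiber) (simp add: W_sum)
    show "word_coeff (index_word as) summable_on UNIV"
      using smm word_coeff_nonneg by (intro norm_summable_imp_summable_on) simp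
  qed (use W_nonneg in auto)
  then have "(\<lambda>(n, ms). norm (of_real (W ms) * z ^ n)) summable_on Sigma UNIV (incr_fiber r)"
    using Infinite_Sum.abs_summable_on_comparison_test'[of "\<lambda>(n, ms). W ms" "Sigma UNIV (incr_fiber r)"
        "\<lambda>(n, ms). of_real (W ms) * z ^ n"] assms(2) W_nonneg
    by (auto simp: norm_mult norm_power mult_left_le power_le_one case_prod_unfold)
  then have "(\<lambda>(n, ms). of_real (W ms) * z ^ n) summable_on Sigma UNIV (incr_fiber r)"
    using abs_summable_summable[of "\<lambda>(n, ms). of_real (W ms) * z ^ n"]
    by (simp add: case_prod_unfold)
  moreover have "((\<lambda>n. of_real (word_coeff (index_word as) n) * z ^ n) has_sum
      word_series (index_word as) z) UNIV"
  proof (rule norm_summable_imp_has_sum)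
    show sm: "summable (\<lambda>n. norm (of_real (word_coeff (index_word as) n) * z ^ n))"
      by (rule summable_comparison_test'[OF smm, where N = 0])
        (use assms(2) word_coeff_nonneg in \<open>simp add: norm_mult norm_power mult_left_le power_le_one\<close>)
    show "(\<lambda>n. of_real (word_coeff (index_word as) n) * z ^ n) sums word_series (index_word as) z"
      using summable_norm_cancel[OF sm] by (simp add: word_series_def summable_sums)
  qed
  moreover have "((\<lambda>ms. case (n, ms) of (n, ms) \<Rightarrow> of_real (W ms) * z ^ n) has_sum
      of_real (word_coeff (index_word as) n) * z ^ n) (incr_fiber r n)" for n
    by (intro has_sum_finiteI finite_incr_fiber)
      (simp add: W_sum[symmetric] sum_distrib_right)
  ultimately have "((\<lambda>(n, ms). of_real (W ms) * z ^ n) has_sum word_series (index_word as) z)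
      (Sigma UNIV (incr_fiber r))"
    by (intro has_sum_SigmaI)
  then have "((\<lambda>p. of_real (W (snd p)) * z ^ last (0 # snd p)) has_sum word_series (index_word as) z)
      (Sigma UNIV (incr_fiber r))"
    by (rule has_sum_cong[THEN iffD1, rotated]) (auto simp: incr_fiber_def)
  then have "((\<lambda>ms. of_real (W ms) * z ^ last (0 # ms)) has_sum word_series (index_word as) z)
      (incr_tuples r)"
    using has_sum_reindex_bij_betw[OF bij, of "\<lambda>ms. of_real (W ms) * z ^ last (0 # ms)"] by simp
  then show ?thesis
    unfolding r_def[symmetric]
    by (rule has_sum_cong[THEN iffD1, rotated])
      (use assms(3) in \<open>auto simp: W_def r_def incr_tuples_def\<close>)
qed

theorem mpolylog_eq_word_series:
  assumes "admissible as" "norm z \<le> 1"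
  shows "mpolylog as z = word_series (index_word as) z"
proof (cases "as = []")
  case True
  then show ?thesis
    by (simp add: mpolylog_def word_series_Nil)
next
  case False
  then show ?thesis
    using infsumI[OF mpolylog_has_sum[OF assms]] by (simp add: mpolylog_def)
qed

text \<open>Since \<open>mzv\<close> is a real sum, the complex sum at 1 must first be recognised as
  real: its terms are real, so it equals its own real part by uniqueness of sums.\<close>

lemma mzv_eq_word_series:
  assumes "admissible as"
  shows "complex_of_real (mzv as) = word_series (index_word as) 1"
proof (cases "as = []")
  case False
  define S where "S = word_series (index_word as) 1"
  define W where "W ms = 1 / (\<Prod>j<length as. real (ms ! j) ^ (as ! j))" for ms :: "nat list"
  have S: "((\<lambda>ms. complex_of_real (W ms)) has_sum S) (incr_tuples (length as))"
    using mpolylog_has_sum[OF assms, of 1] False by (simp add: S_def W_def)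
  then have "(W has_sum Re S) (incr_tuples (length as))"
    using has_sum_Re[OF S] by simp
  moreover from this have "complex_of_real (Re S) = S"
    using has_sum_unique[OF has_sum_of_real S] by blast
  moreover have "mzv as = infsum W (incr_tuples (length as))"
    using False by (simp add: mzv_def W_def[abs_def])
  ultimately show ?thesis
    by (simp add: infsumI S_def)
qed (simp add: mzv_def word_series_Nil)

section \<open>Polylogarithmic functions on the circle\<close>

text \<open>Each generator is the constant part of one \<open>lc_term\<close>. Closure under
  products is not built in; it follows from the shuffle product.\<close>

inductive_set mzv_span :: "complex set" where
  base: "admissible_word w \<Longrightarrow>
    (of_rat a + \<i> * of_rat b) * of_real pi ^ q * word_series w 1 \<in> mzv_span"
| add: "x \<in> mzv_span \<Longrightarrow> y \<in> mzv_span \<Longrightarrow> x + y \<in> mzv_span"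

section \<open>The ring of constants\<close>

lemma mzv_span_gauss: "of_rat a + \<i> * of_rat b \<in> mzv_span"
  using mzv_span.base[of "[]" a b 0] by (simp add: word_series_Nil)

lemma mzv_span_of_rat: "of_rat a \<in> mzv_span"
  using mzv_span_gauss[of a 0] by simp

lemma mzv_span_0: "0 \<in> mzv_span"
  using mzv_span_of_rat[of 0] by simp

lemma mzv_span_1: "1 \<in> mzv_span"
  using mzv_span_of_rat[of 1] by simp

lemma mzv_span_of_nat: "of_nat n \<in> mzv_span"
  using mzv_span_of_rat[of "of_nat n"] by simp

lemma mzv_span_ii: "\<i> \<in> mzv_span"
  using mzv_span_gauss[of 0 1] by simp

lemma mzv_span_pi: "of_real pi \<in> mzv_span"
  using mzv_span.base[of "[]" 1 0 1] by (simp add: word_series_Nil)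

lemma mzv_span_word_series: "admissible_word w \<Longrightarrow> word_series w 1 \<in> mzv_span"
  using mzv_span.base[of w 1 0 0] by simp

lemma mzv_span_sum_list: "(\<And>w. w \<in> set ws \<Longrightarrow> f w \<in> mzv_span) \<Longrightarrow> (\<Sum>w\<leftarrow>ws. f w) \<in> mzv_span"
  by (induction ws) (auto intro: mzv_span_0 mzv_span.add)

text \<open>Powers of pi add up, Gaussian rationals multiply, and the shuffle product at 1 rewrites
  the product of two zeta values as a sum of generators.\<close>

lemma mzv_span_mult:
  assumes "x \<in> mzv_span" "y \<in> mzv_span"
  shows "x * y \<in> mzv_span"
  using assms(1)
proof induction
  case (base u a b q)
  note u = base
  show ?case
    using assms(2)
  proof induction
    case (base v c d r)
    have gauss: "(of_rat a + \<i> * of_rat b) * (of_rat c + \<i> * of_rat d) =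
        (of_rat (a * c - b * d) + \<i> * of_rat (a * d + b * c) :: complex)"
      by (simp add: of_rat_mult of_rat_diff of_rat_add algebra_simps)
    have "(of_rat a + \<i> * of_rat b) * of_real pi ^ q * word_series u 1 *
        ((of_rat c + \<i> * of_rat d) * of_real pi ^ r * word_series v 1) =
        ((of_rat a + \<i> * of_rat b) * (of_rat c + \<i> * of_rat d)) * of_real pi ^ (q + r) *
        (word_series u 1 * word_series v 1)"
      by (simp add: power_add)
    also have "\<dots> = (\<Sum>w\<leftarrow>shuffle_words u v.
        (of_rat (a * c - b * d) + \<i> * of_rat (a * d + b * c)) * of_real pi ^ (q + r) * word_series w 1)"
      unfolding gauss word_series_shuffle_1[OF u base] sum_list_const_mult ..
    also have "\<dots> \<in> mzv_span"
      using shuffle_words_admissible[OF _ u base] by (intro mzv_span_sum_list mzv_span.base)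
    finally show ?case .
  next
    case (add x y)
    then show ?case
      by (simp add: distrib_left mzv_span.add)
  qed
next
  case (add x y)
  then show ?case
    by (simp add: distrib_right mzv_span.add)
qed

lemma mzv_span_power: "x \<in> mzv_span \<Longrightarrow> x ^ n \<in> mzv_span"
  by (induction n) (auto intro: mzv_span_1 mzv_span_mult)

lemma mzv_span_uminus: "x \<in> mzv_span \<Longrightarrow> - x \<in> mzv_span"
  using mzv_span_mult[OF mzv_span_of_rat[of "-1"]] by (simp add: of_rat_minus)

lemma mzv_span_diff: "x \<in> mzv_span \<Longrightarrow> y \<in> mzv_span \<Longrightarrow> x - y \<in> mzv_span"
  using mzv_span.add[OF _ mzv_span_uminus] by force

lemmas mzv_span_intros = mzv_span_0 mzv_span_1 mzv_span_of_nat mzv_span_ii mzv_span_pi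
  mzv_span.add mzv_span_mult mzv_span_power mzv_span_uminus mzv_span_diff

text \<open>Membership only constrains the values on the open, resp. closed, interval from 0 to \<open>2\<pi>\<close>.\<close>

inductive_set hyperlog_span :: "(real \<Rightarrow> complex) set" where
  base: "c \<in> mzv_span \<Longrightarrow> convergent_word w \<Longrightarrow>
    (\<And>x. x \<in> {0<..<2*pi} \<Longrightarrow> f x = c * of_real x ^ p * hyperlog w (cis x)) \<Longrightarrow> f \<in> hyperlog_span"
| add: "f \<in> hyperlog_span \<Longrightarrow> g \<in> hyperlog_span \<Longrightarrow>
    (\<And>x. x \<in> {0<..<2*pi} \<Longrightarrow> h x = f x + g x) \<Longrightarrow> h \<in> hyperlog_span"

inductive_set polylog_span :: "(real \<Rightarrow> complex) set" where
  base: "c \<in> mzv_span \<Longrightarrow> admissible_word w \<Longrightarrow>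
    (\<And>x. x \<in> {0..2*pi} \<Longrightarrow> f x = c * of_real x ^ p * word_series w (cis x)) \<Longrightarrow> f \<in> polylog_span"
| add: "f \<in> polylog_span \<Longrightarrow> g \<in> polylog_span \<Longrightarrow>
    (\<And>x. x \<in> {0..2*pi} \<Longrightarrow> h x = f x + g x) \<Longrightarrow> h \<in> polylog_span"

section \<open>The algebra of functions on the open period\<close>

lemma cis_in_slit:
  assumes "x \<in> {0<..<2*pi}"
  shows "cis x \<in> slit"
proof (rule in_slit_if_Re_less)
  have "cos x \<noteq> 1"
  proof
    assume "cos x = 1"
    then have "sin (x / 2) = 0"
      using cos_double_sin[of "x / 2"] by simp
    then show False
      using assms sin_gt_zero[of "x / 2"] by simp
  qed
  then show "Re (cis x) < 1"
    using cos_le_one[of x] by (simp add: less_le)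
qed

lemma hyperlog_span_const: "c \<in> mzv_span \<Longrightarrow> (\<lambda>_. c) \<in> hyperlog_span"
  by (rule hyperlog_span.base[of c "[]" _ 0]) auto

lemma hyperlog_span_of_real: "complex_of_real \<in> hyperlog_span"
  by (rule hyperlog_span.base[of 1 "[]" _ 1]) (auto intro: mzv_span_1)

lemma hyperlog_span_hyperlog: "convergent_word w \<Longrightarrow> (\<lambda>x. hyperlog w (cis x)) \<in> hyperlog_span"
  by (rule hyperlog_span.base[of 1 w _ 0]) (auto intro: mzv_span_1)

lemma hyperlog_span_cong:
  assumes "f \<in> hyperlog_span" "\<And>x. x \<in> {0<..<2*pi} \<Longrightarrow> g x = f x"
  shows "g \<in> hyperlog_span"
  by (rule hyperlog_span.add[OF assms(1) hyperlog_span_const[OF mzv_span_0]]) (simp add: assms(2))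

lemma hyperlog_span_plus:
  "f \<in> hyperlog_span \<Longrightarrow> g \<in> hyperlog_span \<Longrightarrow> (\<lambda>x. f x + g x) \<in> hyperlog_span"
  by (rule hyperlog_span.add[of f g]) auto

lemma hyperlog_span_sum_list:
  "(\<And>w. w \<in> set ws \<Longrightarrow> f w \<in> hyperlog_span) \<Longrightarrow> (\<lambda>x. \<Sum>w\<leftarrow>ws. f w x) \<in> hyperlog_span"
  by (induction ws) (auto intro: hyperlog_span_const mzv_span_0 hyperlog_span_plus)

text \<open>The shuffle product on the slit plane linearises the product of two generators;
  \<open>cis x\<close> stays in \<open>slit\<close> on the open period.\<close>

lemma hyperlog_span_mult:
  assumes "f \<in> hyperlog_span" "g \<in> hyperlog_span"
  shows "(\<lambda>x. f x * g x) \<in> hyperlog_span"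
  using assms(1)
proof induction
  case (base c u f p)
  note f = base
  show ?case
    using assms(2)
  proof induction
    case (base d v g q)
    have "(\<lambda>x. \<Sum>w\<leftarrow>shuffle_words u v. (c * d) * of_real x ^ (p + q) * hyperlog w (cis x))
        \<in> hyperlog_span"
    proof (rule hyperlog_span_sum_list)
      fix w assume "w \<in> set (shuffle_words u v)"
      then have "convergent_word w"
        using shuffle_words_convergent f(2) base(2) by blast
      then show "(\<lambda>x. (c * d) * of_real x ^ (p + q) * hyperlog w (cis x)) \<in> hyperlog_span"
        by (rule hyperlog_span.base[OF mzv_span_mult[OF f(1) base(1)]]) (rule refl)
    qed
    then show ?case
    proof (rule hyperlog_span_cong)
      fix x assume x: "x \<in> {0<..<2*pi}"
      have "f x * g x = (c * d) * of_real x ^ (p + q) * (hyperlog u (cis x) * hyperlog v (cis x))"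
        by (simp add: f(3)[OF x] base(3)[OF x] power_add)
      then show "f x * g x =
          (\<Sum>w\<leftarrow>shuffle_words u v. (c * d) * of_real x ^ (p + q) * hyperlog w (cis x))"
        unfolding hyperlog_shuffle[OF f(2) base(2) cis_in_slit[OF x]] sum_list_const_mult .
    qed
  next
    case (add g h k)
    show ?case
      by (rule hyperlog_span.add[OF add.IH]) (simp add: add.hyps algebra_simps)
  qed
next
  case (add f h k)
  show ?case
    by (rule hyperlog_span.add[OF add.IH]) (simp add: add.hyps algebra_simps)
qed

lemma hyperlog_span_power: "f \<in> hyperlog_span \<Longrightarrow> (\<lambda>x. f x ^ n) \<in> hyperlog_span"
  by (induction n) (auto intro: hyperlog_span_const mzv_span_1 hyperlog_span_mult)

text \<open>Both sides are primitives of 1/(1-z) that vanish at 0.\<close>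

lemma hyperlog_True:
  assumes "z \<in> slit"
  shows "hyperlog [True] z = - Ln (1 - z)"
proof (rule primitive_unique[OF connected_slit open_slit zero_in_slit,
      where f = "hyperlog [True]" and g = "\<lambda>z. - Ln (1 - z)" and h = "letter_form True"])
  have conv: "convergent_word [True]"
    by (simp add: convergent_word_def)
  show "continuous_on slit (hyperlog [True])"
    by (rule hyperlog_continuous[OF conv])
  show "continuous_on slit (\<lambda>z. - Ln (1 - z))"
    by (intro continuous_intros) (auto simp: slit_def)
  show "hyperlog [True] 0 = - Ln (1 - 0)"
    by (simp add: hyperlog_0[OF conv])
  fix z assume z: "z \<in> slit - {0}"
  show "(hyperlog [True] has_field_derivative letter_form True z) (at z)"
    using hyperlog_deriv[OF conv, of z] z by simp
  show "((\<lambda>z. - Ln (1 - z)) has_field_derivative letter_form True z) (at z)"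
    using z by (auto intro!: derivative_eq_intros simp: slit_def letter_form_def field_simps)
qed fact

lemma logsineA_eq_hyperlog:
  assumes "x \<in> {0<..<2*pi}"
  shows "complex_of_real (logsineA x) =
    - hyperlog [True] (cis x) + (- \<i> * of_rat (1/2)) * of_real x + \<i> * of_rat (1/2) * of_real pi"
proof -
  have s: "sin (x / 2) > 0"
    using assms by (intro sin_gt_zero) auto
  define L where "L = complex_of_real (logsineA x) + \<i> * of_real ((x - pi) / 2)"
  have "exp L = of_real (exp (logsineA x)) * cis ((x - pi) / 2)"
    unfolding L_def exp_add cis_conv_exp by (simp add: exp_of_real)
  also have "exp (logsineA x) = 2 * sin (x / 2)"
    using s by (simp add: logsineA_def)
  also have "of_real (2 * sin (x / 2)) * cis ((x - pi) / 2) = 1 - cis x"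
  proof -
    have "cos ((x - pi) / 2) = sin (x / 2)" "sin ((x - pi) / 2) = - cos (x / 2)"
      unfolding diff_divide_distrib cos_diff sin_diff by simp_all
    then show ?thesis
      using sin_double[of "x / 2"] cos_double_sin[of "x / 2"]
      by (simp add: complex_eq_iff power2_eq_square)
  qed
  \<comment> \<open>The imaginary part (x-pi)/2 of \<open>L\<close> lies strictly between -pi/2 and
    pi/2, so \<open>L\<close> is the principal logarithm.\<close>
  finally have "Ln (1 - cis x) = L"
    using assms by (intro Ln_unique) (auto simp: L_def)
  then show ?thesis
    using hyperlog_True[OF cis_in_slit[OF assms]]
    by (simp add: L_def of_rat_divide field_simps)
qed

lemma hyperlog_span_logsineA: "(\<lambda>x. complex_of_real (logsineA x)) \<in> hyperlog_span"
proof -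
  have "(\<lambda>x. (- 1) * hyperlog [True] (cis x) + (- \<i> * of_rat (1/2)) * complex_of_real x +
      \<i> * of_rat (1/2) * of_real pi) \<in> hyperlog_span"
    by (intro hyperlog_span_plus hyperlog_span_mult hyperlog_span_const hyperlog_span_hyperlog
        hyperlog_span_of_real mzv_span_intros mzv_span_of_rat)
      (simp add: convergent_word_def)
  then show ?thesis
    by (rule hyperlog_span_cong) (simp add: logsineA_eq_hyperlog)
qed

text \<open>Lets an iterated integral of smaller depth, once known to be in
  \<open>polylog_span\<close>, re-enter as a factor of the next integrand.\<close>

lemma polylog_span_subset: "f \<in> polylog_span \<Longrightarrow> f \<in> hyperlog_span"
proof (induction rule: polylog_span.induct)
  case (base c w f p)
  then show ?case
    using cis_in_slit
    by (intro hyperlog_span.base[of c w _ p])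
      (auto simp: admissible_imp_convergent_word hyperlog_eq_word_series)
next
  case (add f g h)
  then show ?case
    by (intro hyperlog_span.add[of f g h]) auto
qed

section \<open>Continuity and endpoint values\<close>

lemma polylog_span_const: "c \<in> mzv_span \<Longrightarrow> (\<lambda>_. c) \<in> polylog_span"
  by (rule polylog_span.base[of c "[]" _ 0]) (auto simp: word_series_Nil)

lemma polylog_span_plus:
  "f \<in> polylog_span \<Longrightarrow> g \<in> polylog_span \<Longrightarrow> (\<lambda>x. f x + g x) \<in> polylog_span"
  by (rule polylog_span.add[of f g]) auto

lemma polylog_span_cong:
  assumes "f \<in> polylog_span" "\<And>x. x \<in> {0..2*pi} \<Longrightarrow> g x = f x"
  shows "g \<in> polylog_span"
  by (rule polylog_span.add[OF assms(1) polylog_span_const[OF mzv_span_0]]) (simp add: assms(2))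

lemma polylog_span_continuous: "f \<in> polylog_span \<Longrightarrow> continuous_on {0..2*pi} f"
proof (induction rule: polylog_span.induct)
  case (base c w f p)
  have "continuous_on {0..2*pi} (\<lambda>x. word_series w (cis x))"
    by (rule continuous_on_compose2[OF word_series_continuous_cball[OF base(2)]])
      (auto intro!: continuous_intros)
  then have "continuous_on {0..2*pi} (\<lambda>x. c * of_real x ^ p * word_series w (cis x))"
    by (intro continuous_intros)
  then show ?case
    by (rule continuous_on_eq) (simp add: base(3))
next
  case (add f g h)
  then have "continuous_on {0..2*pi} (\<lambda>x. f x + g x)"
    by (intro continuous_intros)
  then show ?case
    by (rule continuous_on_eq) (simp add: add.hyps)
qed

lemma hyperlog_span_continuous: "f \<in> hyperlog_span \<Longrightarrow> continuous_on {0<..<2*pi} f"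
proof (induction rule: hyperlog_span.induct)
  case (base c w f p)
  have "continuous_on {0<..<2*pi} (\<lambda>x. hyperlog w (cis x))"
    by (rule continuous_on_compose2[OF hyperlog_continuous[OF base(2)]])
      (auto intro!: continuous_intros cis_in_slit)
  then have "continuous_on {0<..<2*pi} (\<lambda>x. c * of_real x ^ p * hyperlog w (cis x))"
    by (intro continuous_intros)
  then show ?case
    by (rule continuous_on_eq) (simp add: base(3))
next
  case (add f g h)
  then have "continuous_on {0<..<2*pi} (\<lambda>x. f x + g x)"
    by (intro continuous_intros)
  then show ?case
    by (rule continuous_on_eq) (simp add: add.hyps)
qed

text \<open>At 0 and at 2 pi the point on the circle is 1, so only powers of 0 or 2 pi and series
  values at 1 occur.\<close>

lemma polylog_span_endpoints: "f \<in> polylog_span \<Longrightarrow> f 0 \<in> mzv_span \<and> f (2*pi) \<in> mzv_span"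
proof (induction rule: polylog_span.induct)
  case (base c w f p)
  have "c * 0 ^ p * word_series w 1 \<in> mzv_span" "c * (of_nat 2 * of_real pi) ^ p * word_series w 1 \<in> mzv_span"
    by (intro mzv_span_intros mzv_span_word_series base)+
  then show ?case
    using base(3)[of 0] base(3)[of "2*pi"] by simp
next
  case (add f g h)
  then show ?case
    by (simp add: mzv_span.add)
qed

section \<open>Antiderivatives along the circle\<close>

lemma hyperlog_cis_deriv:
  assumes "convergent_word (False # w)" "x \<in> {0<..<2*pi}"
  shows "((\<lambda>x. hyperlog (False # w) (cis x)) has_vector_derivative \<i> * hyperlog w (cis x)) (at x)"
proof -
  have "(cis has_vector_derivative \<i> * cis x) (at x)"
    unfolding cis_conv_exp[abs_def]
    by (rule has_vector_derivative_real_field[of "\<lambda>z. exp (\<i> * z)"])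
      (auto intro!: derivative_eq_intros)
  moreover have "(hyperlog (False # w) has_field_derivative
      letter_form False (cis x) * hyperlog w (cis x)) (at (cis x))"
    using assms by (intro hyperlog_deriv cis_in_slit) auto
  ultimately have "((hyperlog (False # w) \<circ> cis) has_vector_derivative
      \<i> * cis x * (letter_form False (cis x) * hyperlog w (cis x))) (at x)"
    by (rule field_vector_diff_chain_at)
  then show ?thesis
    by (simp add: o_def letter_form_def)
qed

lemma of_real_power_deriv:
  "((\<lambda>x. complex_of_real x ^ p) has_vector_derivative of_nat p * of_real x ^ (p - 1)) (at x)"
proof -
  have "((\<lambda>x. x ^ p) has_real_derivative real p * x ^ (p - 1)) (at x)"
    by (auto intro!: derivative_eq_intros)
  from has_vector_derivative_of_real[OF this] show ?thesis
    by simp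
qed

text \<open>On the circle dz/z becomes i dx, so integrating a hyperlogarithm prefixes
  \<open>False\<close> to its word. Integration by parts lowers \<open>p\<close> step by step, and
  every word produced starts with \<open>False\<close> and is thus admissible, even when
  \<open>w\<close> is merely convergent.\<close>

lemma polylog_span_antiderivative_monomial:
  assumes "c \<in> mzv_span" "convergent_word w"
  shows "\<exists>H\<in>polylog_span. \<forall>x\<in>{0<..<2*pi}.
    (H has_vector_derivative c * of_real x ^ p * hyperlog w (cis x)) (at x)"
proof (cases "w = []")
  \<comment> \<open>The empty word cannot be prefixed with \<open>False\<close>, as dz/z is not
    integrable at 0; here the plain power of x is integrated.\<close>
  case True
  define H where "H x = (c * of_rat (1 / of_nat (Suc p))) * of_real x ^ Suc p * word_series [] (cis x)" for x
  have "H \<in> polylog_span"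
    unfolding H_def[abs_def]
    by (rule polylog_span.base[of "c * of_rat (1 / of_nat (Suc p))" "[]" _ "Suc p"])
      (auto intro: mzv_span_mult mzv_span_of_rat assms)
  moreover have "(H has_vector_derivative c * of_real x ^ p * hyperlog w (cis x)) (at x)" for x
  proof -
    have "(H has_vector_derivative (c * of_rat (1 / of_nat (Suc p))) * (of_nat (Suc p) * of_real x ^ p)) (at x)"
      unfolding H_def[abs_def] word_series_Nil mult_1_right
      using of_real_power_deriv[of "Suc p" x]
      by (intro has_vector_derivative_mult_right) simp
    moreover have "of_rat (1 / of_nat (Suc p)) * of_nat (Suc p) = (1 :: complex)"
      by (simp add: of_rat_divide del: of_nat_Suc)
    ultimately show ?thesis
      using True by (simp add: mult.assoc[symmetric] del: of_nat_Suc) (simp add: mult.assoc del: of_nat_Suc)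
  qed
  ultimately show ?thesis
    by blast
next
  case False
  then show ?thesis
    using assms
  proof (induction p arbitrary: c w)
    case p: (0 c w)
    then have conv: "convergent_word (False # w)" "admissible_word (False # w)"
      by (auto simp: convergent_word_Cons admissible_word_Cons)
    define H where "H x = (- \<i> * c) * of_real x ^ 0 * word_series (False # w) (cis x)" for x
    have "H \<in> polylog_span"
      unfolding H_def[abs_def]
      by (rule polylog_span.base[of "- \<i> * c" "False # w" _ 0]) (auto intro!: mzv_span_intros p conv)
    moreover have "(H has_vector_derivative c * of_real x ^ 0 * hyperlog w (cis x)) (at x)"
      if x: "x \<in> {0<..<2*pi}" for x
    proof (rule has_vector_derivative_transform_within_open[OF _ open_greaterThanLessThan x])
      show "((\<lambda>x. (- \<i> * c) * hyperlog (False # w) (cis x)) has_vector_derivative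
          c * of_real x ^ 0 * hyperlog w (cis x)) (at x)"
        using has_vector_derivative_mult_right[OF hyperlog_cis_deriv[OF conv(1) x], of "- \<i> * c"]
        by (simp add: algebra_simps)
      show "(- \<i> * c) * hyperlog (False # w) (cis y) = H y" if "y \<in> {0<..<2*pi}" for y
        using that conv cis_in_slit by (simp add: H_def hyperlog_eq_word_series)
    qed
    ultimately show ?case
      by blast
  next
    case (Suc p c w)
    then have conv: "convergent_word (False # w)" "admissible_word (False # w)"
      by (auto simp: convergent_word_Cons admissible_word_Cons)
    define H where "H x = (- \<i> * c) * of_real x ^ Suc p * word_series (False # w) (cis x)" for x
    have H: "H \<in> polylog_span"
      unfolding H_def[abs_def]
      by (rule polylog_span.base[of "- \<i> * c" "False # w" _ "Suc p"])
        (auto intro!: mzv_span_intros Suc.prems conv)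
    \<comment> \<open>Chosen to cancel the term left over when the power of x in \<open>H\<close> is
      differentiated.\<close>
    define c' where "c' = \<i> * c * of_nat (Suc p)"
    have "c' \<in> mzv_span"
      unfolding c'_def by (intro mzv_span_intros Suc.prems)
    then obtain H2 where H2: "H2 \<in> polylog_span" "\<And>x. x \<in> {0<..<2*pi} \<Longrightarrow>
        (H2 has_vector_derivative c' * of_real x ^ p * hyperlog (False # w) (cis x)) (at x)"
      using Suc.IH[of "False # w" c'] conv by blast
    have "((\<lambda>x. H x + H2 x) has_vector_derivative c * of_real x ^ Suc p * hyperlog w (cis x)) (at x)"
      if x: "x \<in> {0<..<2*pi}" for x
    proof -
      have "(H has_vector_derivative (- \<i> * c) * (of_real x ^ Suc p * (\<i> * hyperlog w (cis x)) +
          of_nat (Suc p) * of_real x ^ p * hyperlog (False # w) (cis x))) (at x)"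
      proof (rule has_vector_derivative_transform_within_open[OF _ open_greaterThanLessThan x])
        show "((\<lambda>x. (- \<i> * c) * (of_real x ^ Suc p * hyperlog (False # w) (cis x))) has_vector_derivative
            (- \<i> * c) * (of_real x ^ Suc p * (\<i> * hyperlog w (cis x)) +
            of_nat (Suc p) * of_real x ^ p * hyperlog (False # w) (cis x))) (at x)"
          using of_real_power_deriv[of "Suc p" x]
          by (intro has_vector_derivative_mult_right has_vector_derivative_mult
              hyperlog_cis_deriv[OF conv(1) x]) simp
        show "(- \<i> * c) * (of_real y ^ Suc p * hyperlog (False # w) (cis y)) = H y"
          if "y \<in> {0<..<2*pi}" for y
          using that conv cis_in_slit by (simp add: H_def hyperlog_eq_word_series)
      qed
      from has_vector_derivative_add[OF this H2(2)[OF x]] show ?thesis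
        by (simp add: c'_def algebra_simps)
    qed
    then show ?case
      using polylog_span_plus[OF H H2(1)] by blast
  qed
qed

theorem polylog_span_antiderivative:
  assumes "f \<in> hyperlog_span"
  shows "\<exists>H\<in>polylog_span. \<forall>x\<in>{0<..<2*pi}. (H has_vector_derivative f x) (at x)"
  using assms
proof induction
  case (base c w f p)
  then show ?case
    using polylog_span_antiderivative_monomial[of c w p] by auto
next
  case (add f g h)
  then obtain F G where "F \<in> polylog_span" "G \<in> polylog_span"
    "\<forall>x\<in>{0<..<2*pi}. (F has_vector_derivative f x) (at x)"
    "\<forall>x\<in>{0<..<2*pi}. (G has_vector_derivative g x) (at x)"
    by blast
  then show ?case
    using add.hyps by (intro bexI[of _ "\<lambda>x. F x + G x"]) (auto intro: polylog_span_plus has_vector_derivative_add)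
qed

section \<open>Explicit linear combinations\<close>

lemma lc_eval_append: "lc_eval (ts @ us) \<sigma> = lc_eval ts \<sigma> + lc_eval us \<sigma>"
  by (simp add: lc_eval_def)

text \<open>One generator of \<open>mzv_span\<close> times one of \<open>polylog_span\<close> is
  exactly one term, the two words being decoded into admissible indices; sums become concatenated
  lists.\<close>

theorem polylog_span_imp_lc_eval:
  assumes "f \<in> polylog_span"
  shows "\<exists>ts. (\<forall>t\<in>set ts. lc_term_ok t) \<and> (\<forall>x\<in>{0..2*pi}. f x = lc_eval ts x)"
  using assms
proof induction
  case (base c w f p)
  obtain as where as: "index_word as = w" "admissible as"
    using admissible_word_imp_index[OF base(2)] by blast
  have "\<exists>ts. (\<forall>t\<in>set ts. lc_term_ok t) \<and>
      (\<forall>x\<in>{0..2*pi}. c * of_real x ^ p * word_series w (cis x) = lc_eval ts x)"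
    using base(1)
  proof induction
    case (base u a b q)
    obtain zs where zs: "index_word zs = u" "admissible zs"
      using admissible_word_imp_index[OF base] by blast
    show ?case
      using as zs
      by (intro exI[of _ "[(a, b, p, q, zs, as)]"])
        (auto simp: lc_term_ok_def lc_eval_def mzv_eq_word_series mpolylog_eq_word_series cis_conv_exp)
  next
    case (add x y)
    then obtain ts us where "\<forall>t\<in>set ts. lc_term_ok t" "\<forall>t\<in>set us. lc_term_ok t"
      "\<forall>s\<in>{0..2*pi}. x * of_real s ^ p * word_series w (cis s) = lc_eval ts s"
      "\<forall>s\<in>{0..2*pi}. y * of_real s ^ p * word_series w (cis s) = lc_eval us s"
      by blast
    then show ?case
      by (intro exI[of _ "ts @ us"]) (auto simp: lc_eval_append algebra_simps)
  qed
  then show ?case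
    using base(3) by auto
next
  case (add f g h)
  then obtain ts us where "\<forall>t\<in>set ts. lc_term_ok t" "\<forall>t\<in>set us. lc_term_ok t"
    "\<forall>x\<in>{0..2*pi}. f x = lc_eval ts x" "\<forall>x\<in>{0..2*pi}. g x = lc_eval us x"
    by blast
  then show ?case
    using add.hyps by (intro exI[of _ "ts @ us"]) (auto simp: lc_eval_append)
qed

section \<open>Iterated log-sine integrals\<close>

lemma logsineA_shift: "logsineA (2 * real m * pi + x) = logsineA x"
proof -
  have "sin ((2 * real m * pi + x) / 2) = (-1) ^ m * sin (x / 2)"
    by (simp add: add_divide_distrib sin_add mult.assoc)
  then show ?thesis
    by (simp add: logsineA_def abs_mult power_abs)
qed

lemma logsineA_minus: "logsineA (- x) = logsineA x"
  by (simp add: logsineA_def)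

text \<open>Transports the antiderivative from the base period to the one starting at
  \<open>a\<close>; continuity up to both ends is what the fundamental theorem needs there.\<close>

lemma hyperlog_span_antiderivative_shifted:
  assumes "(\<lambda>x. f (a + x)) \<in> hyperlog_span"
  obtains H where "H \<in> polylog_span"
    and "\<And>t. t \<in> {a<..<a + 2*pi} \<Longrightarrow> ((\<lambda>t. H (t - a)) has_vector_derivative f t) (at t)"
    and "continuous_on {a..a + 2*pi} (\<lambda>t. H (t - a))"
proof -
  obtain H where H: "H \<in> polylog_span"
    "\<And>x. x \<in> {0<..<2*pi} \<Longrightarrow> (H has_vector_derivative f (a + x)) (at x)"
    using polylog_span_antiderivative[OF assms] by blast
  have "((\<lambda>t. H (t - a)) has_vector_derivative f t) (at t)" if "t \<in> {a<..<a + 2*pi}" for t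
  proof -
    have "((H \<circ> (\<lambda>t. t - a)) has_vector_derivative 1 *\<^sub>R f t) (at t)"
      using H(2)[of "t - a"] that
      by (intro vector_diff_chain_at) (auto intro!: derivative_eq_intros)
    then show ?thesis
      by (simp add: o_def)
  qed
  moreover have "continuous_on {a..a + 2*pi} (\<lambda>t. H (t - a))"
    by (rule continuous_on_compose2[OF polylog_span_continuous[OF H(1)]])
      (auto intro!: continuous_intros)
  ultimately show thesis
    using that H(1) by blast
qed

lemma hyperlog_span_continuous_shifted:
  assumes "(\<lambda>x. f (a + x)) \<in> hyperlog_span"
  shows "continuous_on {a<..<a + 2*pi} f"
proof -
  have "continuous_on {a<..<a + 2*pi} (\<lambda>t. f (a + (t - a)))"
    by (rule continuous_on_compose2[OF hyperlog_span_continuous[OF assms]])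
      (auto intro!: continuous_intros)
  then show ?thesis
    by simp
qed

text \<open>An even power is nonnegative, so its bounded antiderivative already gives integrability;
  this dominates all other powers.\<close>

lemma set_integrable_logsineA_even_power:
  "set_integrable lborel {2 * real m * pi<..<2 * real m * pi + 2*pi} (\<lambda>t. logsineA t ^ (2 * j))"
proof -
  define a where "a = 2 * real m * pi"
  have span: "(\<lambda>x. complex_of_real (logsineA (a + x) ^ (2 * j))) \<in> hyperlog_span"
    using hyperlog_span_power[OF hyperlog_span_logsineA, of "2 * j"]
    by (simp add: a_def logsineA_shift)
  obtain H where H:
    "\<And>t. t \<in> {a<..<a + 2*pi} \<Longrightarrow>
      ((\<lambda>t. H (t - a)) has_vector_derivative complex_of_real (logsineA t ^ (2 * j))) (at t)"
    "continuous_on {a..a + 2*pi} (\<lambda>t. H (t - a))"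
    using hyperlog_span_antiderivative_shifted[of "\<lambda>t. complex_of_real (logsineA t ^ (2 * j))", OF span]
    by metis
  have contR: "continuous_on {a..a + 2*pi} (\<lambda>t. Re (H (t - a)))"
    using H(2) by (intro continuous_intros)
  have "set_integrable lborel (einterval (ereal a) (ereal (a + 2*pi))) (\<lambda>t. logsineA t ^ (2 * j))"
  proof (rule interval_integral_FTC_nonneg(1)[where F = "\<lambda>t. Re (H (t - a))"])
    show "ereal a < ereal (a + 2*pi)"
      by simp
    fix t assume t: "ereal a < ereal t" "ereal t < ereal (a + 2*pi)"
    show "((\<lambda>t. Re (H (t - a))) has_real_derivative logsineA t ^ (2 * j)) (at t)"
      using bounded_linear.has_vector_derivative[OF bounded_linear_Re H(1)[of t]] t
      by (simp add: has_real_derivative_iff_has_vector_derivative)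
    have "continuous_on {a<..<a + 2*pi} (\<lambda>t. Re (complex_of_real (logsineA t ^ (2 * j))))"
      using hyperlog_span_continuous_shifted[of "\<lambda>t. complex_of_real (logsineA t ^ (2 * j))", OF span]
      by (rule continuous_on_Re)
    then show "isCont (\<lambda>t. logsineA t ^ (2 * j)) t"
      using t by (simp add: continuous_on_eq_continuous_at)
  next
    show "(((\<lambda>t. Re (H (t - a))) \<circ> real_of_ereal) \<longlongrightarrow> Re (H (a - a))) (at_right (ereal a))"
      using continuous_on_Icc_at_rightD[OF contR] by (simp add: ereal_tendsto_simps)
    show "(((\<lambda>t. Re (H (t - a))) \<circ> real_of_ereal) \<longlongrightarrow> Re (H (a + 2*pi - a))) (at_left (ereal (a + 2*pi)))"
      using continuous_on_Icc_at_leftD[OF contR] by (simp add: ereal_tendsto_simps)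
  qed (simp add: power_mult)
  then show ?thesis
    by (simp add: a_def einterval_eq_Icc)
qed

text \<open>\<open>F\<close> is bounded on the compact period, and the power of the logarithm is
  dominated by 1 plus its square, an even power.\<close>

lemma set_integrable_logsineA_power_mult:
  fixes F :: "real \<Rightarrow> real" and m :: nat
  defines "a \<equiv> 2 * real m * pi"
  assumes "continuous_on {a..a + 2*pi} F"
    and "continuous_on {a<..<a + 2*pi} (\<lambda>t. logsineA t ^ j * F t)"
  shows "set_integrable lborel {a<..<a + 2*pi} (\<lambda>t. logsineA t ^ j * F t)"
proof -
  obtain B where B: "\<And>t. t \<in> {a..a + 2*pi} \<Longrightarrow> \<bar>F t\<bar> \<le> B"
  proof -
    have "bounded (F ` {a..a + 2*pi})"
      using assms(2) compact_continuous_image compact_imp_bounded compact_Icc by blast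
    then show ?thesis
      using that unfolding bounded_iff by (metis imageI real_norm_def)
  qed
  have "set_integrable lborel {a<..<a + 2*pi} (\<lambda>t. B * (1 + logsineA t ^ (2 * j)))"
    using set_integrable_logsineA_even_power[of m j]
    by (intro set_integrable_mult_right set_integral_add) (auto simp: a_def set_integrable_def)
  moreover have "set_borel_measurable lborel {a<..<a + 2*pi} (\<lambda>t. logsineA t ^ j * F t)"
    using borel_measurable_continuous_on_indicator[OF _ assms(3)]
    by (simp add: set_borel_measurable_def)
  moreover have "norm (logsineA t ^ j * F t) \<le> norm (B * (1 + logsineA t ^ (2 * j)))"
    if "t \<in> {a<..<a + 2*pi}" for t
  proof -
    have F: "\<bar>F t\<bar> \<le> B"
      using B that by simp
    \<comment> \<open>Expanding gives \<open>2 * y \<le> 1 + y * y\<close> for y the absolute value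
      of the power, which is more than enough.\<close>
    have "0 \<le> (\<bar>logsineA t ^ j\<bar> - 1)\<^sup>2"
      by simp
    then have "\<bar>logsineA t ^ j\<bar> \<le> 1 + logsineA t ^ (2 * j)"
      by (simp add: power2_diff power_mult[symmetric] power_even_abs mult.commute)
    then have "\<bar>logsineA t ^ j\<bar> * \<bar>F t\<bar> \<le> (1 + logsineA t ^ (2 * j)) * B"
      using F by (intro mult_mono) auto
    also have "\<dots> \<le> \<bar>B * (1 + logsineA t ^ (2 * j))\<bar>"
      by (simp add: mult.commute)
    finally show ?thesis
      by (simp add: abs_mult)
  qed
  then have "AE t in lborel. t \<in> {a<..<a + 2*pi} \<longrightarrow>
      norm (logsineA t ^ j * F t) \<le> norm (B * (1 + logsineA t ^ (2 * j)))"
    by (intro AE_I2) blast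
  ultimately show ?thesis
    by (rule set_integrable_bound)
qed

text \<open>The fundamental theorem on an open interval: \<open>g\<close> may blow up at the ends of
  the period, so integrability is assumed separately, while \<open>H\<close> is continuous up to the
  ends and supplies the boundary values.\<close>

lemma interval_integral_hyperlog_span:
  fixes g :: "real \<Rightarrow> real"
  assumes "(\<lambda>x. complex_of_real (g (a + x))) \<in> hyperlog_span"
    and int: "set_integrable lborel {a<..<a + 2*pi} g"
  shows "\<exists>H\<in>polylog_span. \<forall>\<sigma>\<in>{0..2*pi}.
    complex_of_real (LBINT t=a..a + \<sigma>. g t) = H \<sigma> - H 0"
proof -
  obtain H where H: "H \<in> polylog_span"
    "\<And>t. t \<in> {a<..<a + 2*pi} \<Longrightarrow> ((\<lambda>t. H (t - a)) has_vector_derivative complex_of_real (g t)) (at t)"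
    "continuous_on {a..a + 2*pi} (\<lambda>t. H (t - a))"
    using hyperlog_span_antiderivative_shifted[of "\<lambda>t. complex_of_real (g t)", OF assms(1)] by metis
  have "complex_of_real (LBINT t=a..a + \<sigma>. g t) = H \<sigma> - H 0" if \<sigma>: "\<sigma> \<in> {0..2*pi}" for \<sigma>
  proof (cases "\<sigma> = 0")
    case False
    have contH: "continuous_on {a..a + \<sigma>} (\<lambda>t. H (t - a))"
      using H(3) by (rule continuous_on_subset) (use \<sigma> in auto)
    have "(LBINT t=a..a + \<sigma>. complex_of_real (g t)) = H (a + \<sigma> - a) - H (a - a)"
    proof (rule interval_integral_FTC_integrable[where F = "\<lambda>t. H (t - a)"])
      show "ereal a < ereal (a + \<sigma>)"
        using \<sigma> False by simp
      fix t assume t: "ereal a < ereal t" "ereal t < ereal (a + \<sigma>)"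
      then have t': "t \<in> {a<..<a + 2*pi}"
        using \<sigma> by auto
      show "((\<lambda>t. H (t - a)) has_vector_derivative complex_of_real (g t)) (at t)"
        by (rule H(2)[OF t'])
      show "isCont (\<lambda>t. complex_of_real (g t)) t"
        using hyperlog_span_continuous_shifted[of "\<lambda>t. complex_of_real (g t)", OF assms(1)] t'
        by (simp add: continuous_on_eq_continuous_at)
    next
      have "set_integrable lborel {a<..<a + \<sigma>} g"
        using int by (rule set_integrable_subset) (use \<sigma> in auto)
      then have "integrable lborel (\<lambda>t. complex_of_real (indicator {a<..<a + \<sigma>} t *\<^sub>R g t))"
        unfolding set_integrable_def complex_of_real_integrable_eq .
      then show "set_integrable lborel (einterval (ereal a) (ereal (a + \<sigma>))) (\<lambda>t. complex_of_real (g t))"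
        by (simp add: set_integrable_def scaleR_conv_of_real einterval_eq_Icc)
      show "(((\<lambda>t. H (t - a)) \<circ> real_of_ereal) \<longlongrightarrow> H (a - a)) (at_right (ereal a))"
        using continuous_on_Icc_at_rightD[OF contH] \<sigma> False by (simp add: ereal_tendsto_simps)
      show "(((\<lambda>t. H (t - a)) \<circ> real_of_ereal) \<longlongrightarrow> H (a + \<sigma> - a)) (at_left (ereal (a + \<sigma>)))"
        using continuous_on_Icc_at_leftD[OF contH] \<sigma> False by (simp add: ereal_tendsto_simps)
    qed
    then show ?thesis
      by (simp add: interval_lebesgue_integral_of_real)
  qed simp
  then show ?thesis
    using H(1) by blast
qed

text \<open>Adjacent open pieces miss only their common endpoint, a null set.\<close>

lemma set_integrable_pieces:
  fixes g :: "real \<Rightarrow> real" and p :: real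
  assumes "p > 0" "\<And>m::nat. set_integrable lborel {m * p<..<m * p + p} g"
  shows "set_integrable lborel {0<..<real m * p} g"
proof (induction m)
  case (Suc m)
  have "set_integrable lborel ({0<..<real m * p} \<union> {m * p<..<m * p + p}) g"
    by (intro set_integrable_Un Suc assms) auto
  also have "?this \<longleftrightarrow> set_integrable lborel {0<..<real (Suc m) * p} g"
  proof (rule set_integrable_discrete_difference[where X = "{real m * p}"])
    define q where "q = real m * p"
    have "0 \<le> q" "real (Suc m) * p = q + p"
      using assms(1) by (simp_all add: q_def algebra_simps)
    then show "({0<..<real m * p} \<union> {m * p<..<m * p + p} - {0<..<real (Suc m) * p}) \<union>
        ({0<..<real (Suc m) * p} - ({0<..<real m * p} \<union> {m * p<..<m * p + p})) \<subseteq> {real m * p}"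
      using assms(1) by (auto simp flip: q_def)
  qed auto
  finally show ?case .
qed (simp add: set_integrable_def)

text \<open>Induction on depth with \<open>m\<close> arbitrary, because the integral from 0 runs
  through all earlier periods. It splits into a constant from the full periods and an integral over
  the last one, given by an antiderivative.\<close>

theorem ls_iter_polylog_span:
  "(\<lambda>x. complex_of_real (ls_iter ps (2 * real m * pi + x))) \<in> polylog_span"
proof (induction ps arbitrary: m)
  case Nil
  show ?case
    by (simp add: polylog_span_const mzv_span_1)
next
  case (Cons kl ps)
  obtain k l where kl: "kl = (k, l)"
    by fastforce
  define g where "g t = t ^ l * logsineA t ^ (k - 1 - l) * ls_iter ps t" for t
  have span: "(\<lambda>x. complex_of_real (g (2 * real m * pi + x))) \<in> hyperlog_span" for m
  proof -
    have "(\<lambda>x. (of_nat 2 * of_nat m * of_real pi + complex_of_real x) ^ l *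
        complex_of_real (logsineA x) ^ (k - 1 - l) *
        complex_of_real (ls_iter ps (2 * real m * pi + x))) \<in> hyperlog_span"
      by (intro hyperlog_span_mult hyperlog_span_power hyperlog_span_plus hyperlog_span_const
          hyperlog_span_of_real hyperlog_span_logsineA polylog_span_subset Cons.IH mzv_span_intros)
    then show ?thesis
      by (simp add: g_def logsineA_shift)
  qed
  have int: "set_integrable lborel {2 * real m * pi<..<2 * real m * pi + 2*pi} g" for m
  proof -
    define a where "a = 2 * real m * pi"
    have "continuous_on {a..a + 2*pi} (\<lambda>t. Re (complex_of_real (ls_iter ps (a + (t - a)))))"
      using polylog_span_continuous[OF Cons.IH[of m, folded a_def]]
      by (intro continuous_on_Re, rule continuous_on_compose2) (auto intro!: continuous_intros)
    then have F: "continuous_on {a..a + 2*pi} (\<lambda>t. t ^ l * ls_iter ps t)"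
      by (auto intro!: continuous_intros)
    have "continuous_on {a<..<a + 2*pi} (\<lambda>t. Re (complex_of_real (g t)))"
      using hyperlog_span_continuous_shifted[of "\<lambda>t. complex_of_real (g t)", OF span[of m, folded a_def]]
      by (rule continuous_on_Re)
    then have "continuous_on {a<..<a + 2*pi} (\<lambda>t. logsineA t ^ (k - 1 - l) * (t ^ l * ls_iter ps t))"
      by (simp add: g_def mult_ac)
    from set_integrable_logsineA_power_mult[OF F[unfolded a_def] this[unfolded a_def]]
    show ?thesis
      by (simp add: g_def[abs_def] mult_ac)
  qed
  have int0: "set_integrable lborel {0<..<2 * real m * pi} g" for m
    using set_integrable_pieces[of "2 * pi" g m] int by (simp add: mult_ac)
  have split: "(LBINT t=0..2 * real m * pi + \<sigma>. g t) =
      (LBINT t=0..2 * real m * pi. g t) + (LBINT t=2 * real m * pi..2 * real m * pi + \<sigma>. g t)"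
    if \<sigma>: "\<sigma> \<in> {0..2*pi}" for m \<sigma>
  proof -
    \<comment> \<open>The range is contained in m+1 full periods because
      \<open>\<sigma> \<le> 2 * pi\<close>.\<close>
    have "set_integrable lborel {0<..<2 * real m * pi + \<sigma>} g"
      using int0[of "Suc m"] by (rule set_integrable_subset) (use \<sigma> in \<open>auto simp: algebra_simps\<close>)
    then have "interval_lebesgue_integrable lborel
        (min 0 (min (ereal (2 * real m * pi)) (ereal (2 * real m * pi + \<sigma>))))
        (max 0 (max (ereal (2 * real m * pi)) (ereal (2 * real m * pi + \<sigma>)))) g"
      using \<sigma> by (simp add: interval_lebesgue_integrable_def einterval_eq_Icc zero_ereal_def min_def max_def)
    from interval_integral_sum[OF this] show ?thesis
      by simp
  qed
  \<comment> \<open>Each full period adds \<open>H (2*pi) - H 0\<close>, a difference of endpoint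
    values and hence a constant of the ring.\<close>
  have const: "complex_of_real (LBINT t=0..2 * real m * pi. g t) \<in> mzv_span" for m
  proof (induction m)
    case 0
    then show ?case
      by (simp add: zero_ereal_def mzv_span_0)
  next
    case (Suc m)
    obtain H where H: "H \<in> polylog_span" "\<forall>\<sigma>\<in>{0..2*pi}. complex_of_real
        (LBINT t=2 * real m * pi..2 * real m * pi + \<sigma>. g t) = H \<sigma> - H 0"
      using interval_integral_hyperlog_span[OF span int] by blast
    have "2 * real (Suc m) * pi = 2 * real m * pi + 2 * pi"
      by (simp add: algebra_simps)
    then have "complex_of_real (LBINT t=0..2 * real (Suc m) * pi. g t) =
        complex_of_real (LBINT t=0..2 * real m * pi. g t) + (H (2*pi) - H 0)"
      using split[of "2*pi" m] H(2) by simp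
    also have "\<dots> \<in> mzv_span"
      using polylog_span_endpoints[OF H(1)] by (intro mzv_span_intros Suc) auto
    finally show ?case .
  qed
  obtain H where H: "H \<in> polylog_span" "\<forall>\<sigma>\<in>{0..2*pi}. complex_of_real
      (LBINT t=2 * real m * pi..2 * real m * pi + \<sigma>. g t) = H \<sigma> - H 0"
    using interval_integral_hyperlog_span[OF span int] by blast
  have "(\<lambda>x. H x + (complex_of_real (LBINT t=0..2 * real m * pi. g t) - H 0)) \<in> polylog_span"
    using polylog_span_endpoints[OF H(1)]
    by (intro polylog_span_plus H polylog_span_const mzv_span_intros const) auto
  then show ?case
    by (rule polylog_span_cong) (use H(2) split in \<open>simp add: kl g_def\<close>)
qed

text \<open>Reflection reverses the orientation and \<open>logsineA\<close> is even, so each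
  integration contributes the sign \<open>- ((-1) ^ l)\<close>. The total sign depends on
  \<open>ps\<close> alone, not on \<open>x\<close>.\<close>

lemma ls_iter_minus: "\<exists>s\<in>{1, -1}. \<forall>x. ls_iter ps (- x) = s * ls_iter ps x"
proof (induction ps)
  case (Cons kl ps)
  obtain k l where kl: "kl = (k, l)"
    by fastforce
  obtain s where s: "s \<in> {1, -1}" "\<And>x. ls_iter ps (- x) = s * ls_iter ps x"
    using Cons by blast
  define g where "g t = t ^ l * logsineA t ^ (k - 1 - l) * ls_iter ps t" for t
  have g: "g (- t) = (-1) ^ l * s * g t" for t
    by (simp add: g_def s(2) logsineA_minus power_minus[of t])
  have "ls_iter (kl # ps) (- x) = - ((-1) ^ l * s) * ls_iter (kl # ps) x" for x
  proof -
    have "(LBINT t=0..ereal (- x). g t) = (LBINT t=ereal x..0. g (- t))"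
      by (subst interval_integral_reflect) simp
    also have "\<dots> = - (LBINT t=0..ereal x. (-1) ^ l * s * g t)"
      by (subst interval_integral_endpoints_reverse) (simp only: g)
    also have "\<dots> = - ((-1) ^ l * s) * (LBINT t=0..ereal x. g t)"
      by simp
    finally show ?thesis
      by (simp add: kl g_def)
  qed
  moreover have "- ((-1) ^ l * s) \<in> {1, -1}"
    using s(1) by (cases "even l") auto
  ultimately show ?case
    by blast
qed simp

lemma polylog_span_scale:
  assumes "c \<in> mzv_span" "f \<in> polylog_span"
  shows "(\<lambda>x. c * f x) \<in> polylog_span"
  using assms(2)
proof induction
  case (base d w f p)
  show ?case
    by (rule polylog_span.base[OF mzv_span_mult[OF assms(1) base(1)] base(2), where p = p])
      (simp add: base(3))
next
  case (add f g h)
  show ?case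
    by (rule polylog_span.add[OF add.IH]) (simp add: add.hyps distrib_left)
qed

text \<open>For each sign a single list of terms serves all \<open>\<sigma>\<close> in the period:
  membership in \<open>polylog_span\<close> describes the function as a whole rather than its
  separate values.\<close>

theorem theorem2:
  fixes m :: nat and ks ls :: "nat list"
  assumes "length ls = length ks"
    and "\<forall>u<length ks. ls ! u + 1 \<le> ks ! u"
  shows "(\<exists>ts. (\<forall>t\<in>set ts. lc_term_ok t) \<and>
            (\<forall>\<sigma>\<in>{0..2*pi}. complex_of_real (Ls ks ls (2 * real m * pi + \<sigma>)) = lc_eval ts \<sigma>))
       \<and> (\<exists>ts. (\<forall>t\<in>set ts. lc_term_ok t) \<and>
            (\<forall>\<sigma>\<in>{0..2*pi}. complex_of_real (Ls ks ls (- (2 * real m * pi + \<sigma>))) = lc_eval ts \<sigma>))"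
proof -
  define ps where "ps = rev (zip ks ls)"
  obtain s where s: "s \<in> {1, -1}" "\<And>x. ls_iter ps (- x) = s * ls_iter ps x"
    using ls_iter_minus[of ps] by blast
  have s_span: "complex_of_real s \<in> mzv_span"
    using s(1) mzv_span_1 mzv_span_uminus[OF mzv_span_1] by auto
  have pos: "(\<lambda>x. (-1) ^ length ks * complex_of_real (ls_iter ps (2 * real m * pi + x))) \<in> polylog_span"
    by (intro polylog_span_scale ls_iter_polylog_span mzv_span_intros)
  have neg: "(\<lambda>x. complex_of_real s * ((-1) ^ length ks *
      complex_of_real (ls_iter ps (2 * real m * pi + x)))) \<in> polylog_span"
    by (intro polylog_span_scale pos s_span)
  have Ls_pos: "complex_of_real (Ls ks ls x) = (-1) ^ length ks * complex_of_real (ls_iter ps x)" for x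
    by (simp add: Ls_def ps_def)
  have Ls_neg: "complex_of_real (Ls ks ls (- x)) =
      complex_of_real s * ((-1) ^ length ks * complex_of_real (ls_iter ps x))" for x
    by (simp add: Ls_pos s(2))
  show ?thesis
    unfolding Ls_neg unfolding Ls_pos
    using polylog_span_imp_lc_eval[OF pos] polylog_span_imp_lc_eval[OF neg] by blast
qed

end
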